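(* Let $G=\langle W_1,\dots,W_n\mid R_1,\dots,R_m\rangle$ be a finitely presented group with $n\ge2$ generators and at least one relator $R_i$ that is nontrivial in the free group on $W_1,\dots,W_n$, and let $a,b$ be words in $W_1^{\pm1},\dots,W_n^{\pm1}$. Then $a=b$ in $G$ if and only if $FTL_B(G,a)$ and $FTL_B(G,b)$ are Hurwitz equivalent.
   Context: Conjugation notation: $a^b=b^{-1}ab$. Let $F_n$ be free on $z_1,\dots,z_n$ and $\varphi$ the rewriting map from words in $W_i^{\pm1}$ to words in $F_n$ replacing $W_i^{\pm1}$ by $z_i^{\pm1}$. Let $V=(\varphi(R_1),\dots,\varphi(R_m))=(v_1,\dots,v_m)$ and $N$ the normal closure of $\{v_1,\dots,v_m\}$ in $F_n$. For $G_1\oplus G_2$, $R=(R'_1,\dots,R'_p)$, $W=(W'_1,\dots,W'_q)$, $H$ in $G_1$ and $X=(X_1,\dots,X_{q+2})$ in $G_2$, let $P_X(R,W,H)=((R'_1,1),\dots,(R'_p,1),(W'_1,X_1),\dots,(W'_q,X_q),(H^{-1},X_{q+1}),(H,X_{q+2}))$. Let $F_X$ be free on $X_1,\dots,X_{n+1}$ and fix an injective homomorphism $i:F_n\oplus F_X\to F_2\oplus F_2$. For a word $c$ in $F_n$, $FTL_{s1}(c)=i(P_X(V_f,W,c))$ with $V_f=(v_1,\dots,v_m,(v_1\cdots v_m)^{-1})$, $W=(z_1,\dots,z_n,(z_1\cdots z_n)^{-1})$, $X=(X_1,\dots,X_n,(X_1\cdots X_n)^{-1},X_{n+1}^{-1},X_{n+1})$.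 Fix $H\in N$ with no root (i.e. not of the form $w^k$ with $k\neq\pm1$), and set $FTL_{s2}(c)=FTL_{s1}(H^c)$. Finally $FTL_B(G,a)=FTL_{s2}(\varphi(a))$, a $1$-factorization in $F_2\oplus F_2$. The braid group acts on the right on tuples by $(f_1,\dots,f_k)\sigma_i=(\dots,f_{i-1},f_{i+1},f_{i+1}^{-1}f_if_{i+1},f_{i+2},\dots)$, $(f_1,\dots,f_k)\sigma_i^{-1}=(\dots,f_{i-1},f_if_{i+1}f_i^{-1},f_i,f_{i+2},\dots)$; Hurwitz equivalent means in the same orbit. *)

theory Defs
  imports "HOL-Algebra.Coset"
begin

section \<open>Words, free groups and presented groups\<close>

text \<open>The letter \<open>(x, True)\<close> stands for the generator \<open>x\<close> and \<open>(x, False)\<close> for its inverse.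
  Words are arbitrary lists of letters and need not be reduced.\<close>

type_synonym 'a word = "('a \<times> bool) list"

definition words_over :: "'a set \<Rightarrow> 'a word set" where
  "words_over S = lists (S \<times> UNIV)"

fun flip :: "'a \<times> bool \<Rightarrow> 'a \<times> bool" where
  "flip (x, e) = (x, \<not> e)"

fun reduced :: "'a word \<Rightarrow> bool" where
  "reduced (l # l' # w) \<longleftrightarrow> l' \<noteq> flip l \<and> reduced (l' # w)"
| "reduced _ \<longleftrightarrow> True"

fun cons_red :: "'a \<times> bool \<Rightarrow> 'a word \<Rightarrow> 'a word" where
  "cons_red l [] = [l]"
| "cons_red l (l' # w) = (if l' = flip l then w else l # l' # w)"

text \<open>The free group on \<open>S\<close>: reduced words under concatenation followed by free cancellation.\<close>

definition free_group :: "'a set \<Rightarrow> 'a word monoid" where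
  "free_group S = \<lparr>carrier = {w \<in> words_over S. reduced w},
                   mult = (\<lambda>u v. foldr cons_red u v),
                   one = []\<rparr>"

definition free_gen :: "'a \<Rightarrow> 'a word" where
  "free_gen x = [(x, True)]"

definition group_prod :: "('g, 'r) monoid_scheme \<Rightarrow> 'g list \<Rightarrow> 'g" where
  "group_prod G xs = foldr (mult G) xs \<one>\<^bsub>G\<^esub>"

definition word_val :: "('g, 'r) monoid_scheme \<Rightarrow> ('a \<Rightarrow> 'g) \<Rightarrow> 'a word \<Rightarrow> 'g" where
  "word_val G g w = group_prod G (map (\<lambda>(x, e). if e then g x else inv\<^bsub>G\<^esub> g x) w)"

definition free_word :: "'a set \<Rightarrow> 'a word \<Rightarrow> 'a word" where
  "free_word S w = word_val (free_group S) free_gen w"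

definition normal_closure :: "('g, 'r) monoid_scheme \<Rightarrow> 'g set \<Rightarrow> 'g set" where
  "normal_closure G A = \<Inter> {N. N \<lhd> G \<and> A \<subseteq> N}"

definition relator_closure :: "'a set \<Rightarrow> 'a word set \<Rightarrow> 'a word set" where
  "relator_closure S R = normal_closure (free_group S) (free_word S ` R)"

definition presented_group :: "'a set \<Rightarrow> 'a word set \<Rightarrow> 'a word set monoid" where
  "presented_group S R = free_group S Mod relator_closure S R"

definition presented_word :: "'a set \<Rightarrow> 'a word set \<Rightarrow> 'a word \<Rightarrow> 'a word set" where
  "presented_word S R w =
     word_val (presented_group S R)
       (\<lambda>x. relator_closure S R #>\<^bsub>free_group S\<^esub> free_gen x) w"

definition conj_by :: "('g, 'r) monoid_scheme \<Rightarrow> 'g \<Rightarrow> 'g \<Rightarrow> 'g" where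
  "conj_by G a b = inv\<^bsub>G\<^esub> b \<otimes>\<^bsub>G\<^esub> a \<otimes>\<^bsub>G\<^esub> b"

definition has_no_root :: "('g, 'r) monoid_scheme \<Rightarrow> 'g \<Rightarrow> bool" where
  "has_no_root G h \<longleftrightarrow>
     \<not> (\<exists>w \<in> carrier G. \<exists>k::int. k \<noteq> 1 \<and> k \<noteq> -1 \<and> h = w [^]\<^bsub>G\<^esub> k)"

section \<open>Hurwitz equivalence\<close>

text \<open>Positions are counted from \<open>0\<close>, so \<open>hurwitz_sigma G j\<close> is the action of
  \<open>\<sigma>\<^sub>j\<^sub>+\<^sub>1\<close>; it is meaningful for \<open>Suc j < length fs\<close>.\<close>

definition hurwitz_sigma :: "('g, 'r) monoid_scheme \<Rightarrow> nat \<Rightarrow> 'g list \<Rightarrow> 'g list" where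
  "hurwitz_sigma G j fs =
     fs[j := fs ! Suc j,
        Suc j := inv\<^bsub>G\<^esub> (fs ! Suc j) \<otimes>\<^bsub>G\<^esub> fs ! j \<otimes>\<^bsub>G\<^esub> fs ! Suc j]"

definition hurwitz_sigma_inv :: "('g, 'r) monoid_scheme \<Rightarrow> nat \<Rightarrow> 'g list \<Rightarrow> 'g list" where
  "hurwitz_sigma_inv G j fs =
     fs[j := fs ! j \<otimes>\<^bsub>G\<^esub> fs ! Suc j \<otimes>\<^bsub>G\<^esub> inv\<^bsub>G\<^esub> (fs ! j),
        Suc j := fs ! j]"

text \<open>The braid group on \<open>k\<close> strands is generated by \<open>\<sigma>\<^sub>1, \<dots>, \<sigma>\<^sub>k\<^sub>-\<^sub>1\<close>, so its elements are represented by
  words in the letters \<open>(j, True)\<close> and \<open>(j, False)\<close> with \<open>Suc j < k\<close>. The action is a right action: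
  the leftmost letter acts first.\<close>

definition braid_act :: "('g, 'r) monoid_scheme \<Rightarrow> 'g list \<Rightarrow> nat word \<Rightarrow> 'g list" where
  "braid_act G fs \<beta> =
     foldl (\<lambda>gs (j, e). if e then hurwitz_sigma G j gs else hurwitz_sigma_inv G j gs) fs \<beta>"

definition hurwitz_equivalent :: "('g, 'r) monoid_scheme \<Rightarrow> 'g list \<Rightarrow> 'g list \<Rightarrow> bool" where
  "hurwitz_equivalent G fs gs \<longleftrightarrow>
     (\<exists>\<beta> \<in> words_over {j. Suc j < length fs}. braid_act G fs \<beta> = gs)"

section \<open>The factorizations\<close>

text \<open>Intended for \<open>length X = length W + 2\<close>; \<open>zip W X\<close> pairs \<open>W\<close> with the
  first \<open>length W\<close> entries of \<open>X\<close>.\<close>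

definition P_tuple ::
  "('g, 'r) monoid_scheme \<Rightarrow> ('h, 's) monoid_scheme \<Rightarrow> 'h list \<Rightarrow> 'g list \<Rightarrow> 'g list \<Rightarrow> 'g
     \<Rightarrow> ('g \<times> 'h) list" where
  "P_tuple G1 G2 X R W h =
     map (\<lambda>r. (r, \<one>\<^bsub>G2\<^esub>)) R @ zip W X @
     [(inv\<^bsub>G1\<^esub> h, X ! length W), (h, X ! Suc (length W))]"

abbreviation Fr :: "nat \<Rightarrow> nat word monoid" where
  "Fr k \<equiv> free_group {1..k}"

text \<open>\<open>W\<^sub>i\<close>, \<open>z\<^sub>i\<close> and \<open>X\<^sub>i\<close> are all encoded by the index \<open>i\<close>. Hence the free group on the \<open>W\<^sub>i\<close>
  and the free group \<open>F\<^sub>n\<close> on the \<open>z\<^sub>i\<close> are both \<open>Fr n\<close>, \<open>F\<^sub>X\<close> is \<open>Fr (Suc n)\<close>, and the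
  rewriting map \<open>\<phi>\<close> evaluates a word at the free generators.\<close>

definition phi :: "nat \<Rightarrow> nat word \<Rightarrow> nat word" where
  "phi n w = free_word {1..n} w"

definition V_list :: "nat \<Rightarrow> nat word list \<Rightarrow> nat word list" where
  "V_list n Rs = map (phi n) Rs"

definition N_closure :: "nat \<Rightarrow> nat word list \<Rightarrow> nat word set" where
  "N_closure n Rs = normal_closure (Fr n) (set (V_list n Rs))"

definition append_inv_prod :: "('g, 'r) monoid_scheme \<Rightarrow> 'g list \<Rightarrow> 'g list" where
  "append_inv_prod G xs = xs @ [inv\<^bsub>G\<^esub> (group_prod G xs)]"

definition FTL_s1 ::
  "nat \<Rightarrow> nat word list \<Rightarrow> (nat word \<times> nat word \<Rightarrow> nat word \<times> nat word)
     \<Rightarrow> nat word \<Rightarrow> (nat word \<times> nat word) list" where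
  "FTL_s1 n Rs i c =
     (let Vf = append_inv_prod (Fr n) (V_list n Rs);
          W = append_inv_prod (Fr n) (map free_gen [1..<Suc n]);
          X = append_inv_prod (Fr (Suc n)) (map free_gen [1..<Suc n]) @
              [inv\<^bsub>Fr (Suc n)\<^esub> (free_gen (Suc n)), free_gen (Suc n)]
      in map i (P_tuple (Fr n) (Fr (Suc n)) X Vf W c))"

definition FTL_s2 ::
  "nat \<Rightarrow> nat word list \<Rightarrow> (nat word \<times> nat word \<Rightarrow> nat word \<times> nat word)
     \<Rightarrow> nat word \<Rightarrow> nat word \<Rightarrow> (nat word \<times> nat word) list" where
  "FTL_s2 n Rs i h c = FTL_s1 n Rs i (conj_by (Fr n) h c)"

definition FTL_B ::
  "nat \<Rightarrow> nat word list \<Rightarrow> (nat word \<times> nat word \<Rightarrow> nat word \<times> nat word)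
     \<Rightarrow> nat word \<Rightarrow> nat word \<Rightarrow> (nat word \<times> nat word) list" where
  "FTL_B n Rs i h a = FTL_s2 n Rs i h (phi n a)"

section \<open>Well-definedness\<close>

lemma flip_flip [simp]: "flip (flip l) = l"
  by (cases l) simp

lemma flip_neq [simp]: "flip l \<noteq> l"
  by (cases l) simp

lemma reduced_tl: "reduced (l # w) \<Longrightarrow> reduced w"
  by (cases w) auto

lemma reduced_cons_red: "reduced w \<Longrightarrow> reduced (cons_red l w)"
  by (cases w) (auto dest: reduced_tl)

lemma cons_red_flip: "reduced w \<Longrightarrow> cons_red l (cons_red (flip l) w) = w"
  by (cases w; cases "tl w") auto

lemma cons_red_reduced: "reduced (l # w) \<Longrightarrow> cons_red l w = l # w"
  by (cases w) auto

lemma reduced_foldr: "reduced v \<Longrightarrow> reduced (foldr cons_red u v)"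
  by (induction u) (auto intro: reduced_cons_red)

lemma foldr_cons_red_Nil: "reduced u \<Longrightarrow> foldr cons_red u [] = u"
proof (induction u)
  case (Cons l u)
  then show ?case using reduced_tl[OF Cons.prems] cons_red_reduced[OF Cons.prems] by simp
qed simp

lemma foldr_cons_red_assoc:
  assumes "reduced v" "reduced w"
  shows "foldr cons_red (foldr cons_red u v) w = foldr cons_red u (foldr cons_red v w)"
proof (induction u)
  case (Cons l u)
  have "foldr cons_red (cons_red l x) w = cons_red l (foldr cons_red x w)" for x
  proof (cases x)
    case (Cons l' x')
    then show ?thesis
      using cons_red_flip[OF reduced_foldr[OF assms(2)], of l x'] by auto
  qed auto
  then show ?case by (simp add: Cons.IH)
qed simp

lemma words_over_cons_red:
  assumes "l \<in> S \<times> UNIV" "w \<in> words_over S"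
  shows "cons_red l w \<in> words_over S"
  using assms by (cases w) (auto simp: words_over_def)

lemma words_over_foldr:
  assumes "u \<in> words_over S" "v \<in> words_over S"
  shows "foldr cons_red u v \<in> words_over S"
  using assms(1)
proof (induction u)
  case (Cons l u)
  then have "l \<in> S \<times> UNIV" "u \<in> words_over S" by (simp_all add: words_over_def)
  with Cons.IH show ?case by (simp add: words_over_cons_red)
qed (simp add: assms(2))

lemma foldr_inverse_word:
  "reduced v \<Longrightarrow> foldr cons_red (rev (map flip u)) (foldr cons_red u v) = v"
proof (induction u)
  case (Cons l u)
  have "reduced (foldr cons_red u v)" using Cons.prems by (rule reduced_foldr)
  then show ?case
    using Cons cons_red_flip[of "foldr cons_red u v" "flip l"] by simp
qed simp

lemma group_free_group: "group (free_group S)"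
proof (rule groupI)
  fix x assume x: "x \<in> carrier (free_group S)"
  let ?y = "foldr cons_red (rev (map flip x)) []"
  have "rev (map flip x) \<in> words_over S"
    using x by (fastforce simp: free_group_def words_over_def)
  then have "?y \<in> carrier (free_group S)"
    using words_over_foldr[of "rev (map flip x)" S "[]"] reduced_foldr[of "[]" "rev (map flip x)"]
    by (simp add: free_group_def words_over_def)
  moreover have "?y \<otimes>\<^bsub>free_group S\<^esub> x = \<one>\<^bsub>free_group S\<^esub>"
    using x foldr_inverse_word[of "[]" x] foldr_cons_red_assoc[of "[]" x "rev (map flip x)"]
    by (simp add: free_group_def foldr_cons_red_Nil)
  ultimately show "\<exists>y\<in>carrier (free_group S). y \<otimes>\<^bsub>free_group S\<^esub> x = \<one>\<^bsub>free_group S\<^esub>"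
    by blast
qed (auto simp: free_group_def foldr_cons_red_assoc intro: words_over_foldr reduced_foldr,
     auto simp: words_over_def)

lemma normal_normal_closure:
  assumes "group G" "A \<subseteq> carrier G"
  shows "normal_closure G A \<lhd> G"
proof -
  interpret group G by fact
  let ?F = "{N. N \<lhd> G \<and> A \<subseteq> N}"
  have ne: "carrier G \<in> ?F"
    using assms(2) by (auto simp: normal_inv_iff subgroup_self)
  have "subgroup (\<Inter> ?F) G"
    using ne by (intro subgroups_Inter) (auto simp: normal_inv_iff)
  then show ?thesis
    unfolding normal_closure_def normal_inv_iff by (auto simp: normal_inv_iff)
qed

end

theory Submission
  imports Defs "HOL-Algebra.Elementary_Groups"
begin

text \<open>Let \<open>h = H\<^sup>a\<close>. The final block \<open>(h\<^sup>-\<^sup>1, X\<^sub>n\<^sub>+\<^sub>1\<^sup>-\<^sup>1), (h, X\<^sub>n\<^sub>+\<^sub>1)\<close> has product \<open>1\<close>, so it passes through the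
  other entries without changing them; letting one entry pass over it and back conjugates the block
  by that entry. Conjugation by \<open>(\<nu>, 1)\<close> with \<open>\<nu> \<in> N\<close> is available this way, which turns \<open>H\<^sup>a\<close> into \<open>H\<^sup>b\<close>
  when \<open>a = b\<close> in \<open>G\<close>.

  Conversely, Hurwitz moves conjugate \<open>(H\<^sup>a, X\<^sub>n\<^sub>+\<^sub>1)\<close> into \<open>(H\<^sup>b, X\<^sub>n\<^sub>+\<^sub>1)\<close> by a pair \<open>(u, x)\<close>. Here \<open>x\<close>
  commutes with \<open>X\<^sub>n\<^sub>+\<^sub>1\<close>, hence is a power of it, and this forces \<open>u \<in> N\<close>. As \<open>a u b\<^sup>-\<^sup>1\<close> commutes with
  \<open>H\<close>, it is a power of \<open>H\<close> and lies in \<open>N\<close>, so \<open>a = b\<close> in \<open>G\<close>.\<close>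

section \<open>Hurwitz moves\<close>

text \<open>One braid generator or its inverse, written with list patterns instead of positions.
  Contexts, homomorphic images and case splits then need no index arithmetic;
  \<open>hurwitz_equivalent_iff\<close> gives the link with braid words.\<close>

inductive hurwitz_step :: "('g, 'r) monoid_scheme \<Rightarrow> 'g list \<Rightarrow> 'g list \<Rightarrow> bool" for G where
  sigma: "hurwitz_step G (xs @ f # g # ys) (xs @ g # conj_by G f g # ys)"
| sigma_inv: "hurwitz_step G (xs @ f # g # ys)
    (xs @ (f \<otimes>\<^bsub>G\<^esub> g \<otimes>\<^bsub>G\<^esub> inv\<^bsub>G\<^esub> f) # f # ys)"

lemma hurwitz_sigma_append:
  "hurwitz_sigma G (length xs) (xs @ f # g # ys) = xs @ g # conj_by G f g # ys"
  by (simp add: hurwitz_sigma_def conj_by_def nth_append list_update_append)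

lemma hurwitz_sigma_inv_append:
  "hurwitz_sigma_inv G (length xs) (xs @ f # g # ys) =
     xs @ (f \<otimes>\<^bsub>G\<^esub> g \<otimes>\<^bsub>G\<^esub> inv\<^bsub>G\<^esub> f) # f # ys"
  by (simp add: hurwitz_sigma_inv_def nth_append list_update_append)

lemma split_adjacent:
  assumes "Suc j < length fs"
  obtains xs f g ys where "fs = xs @ f # g # ys" "length xs = j"
proof
  show "fs = take j fs @ fs ! j # fs ! Suc j # drop (Suc (Suc j)) fs"
    using assms by (metis Cons_nth_drop_Suc Suc_lessD append_take_drop_id)
  show "length (take j fs) = j" using assms by simp
qed

lemma hurwitz_step_iff:
  "hurwitz_step G fs gs \<longleftrightarrow>
     (\<exists>j e. Suc j < length fs \<and> braid_act G fs [(j, e)] = gs)" (is "?L \<longleftrightarrow> ?R")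
proof
  assume ?L
  then show ?R
  proof cases
    case (sigma xs f g ys)
    then show ?thesis
      by (intro exI[of _ "length xs"] exI[of _ True]) (simp add: braid_act_def hurwitz_sigma_append)
  next
    case (sigma_inv xs f g ys)
    then show ?thesis
      by (intro exI[of _ "length xs"] exI[of _ False]) (simp add: braid_act_def hurwitz_sigma_inv_append)
  qed
next
  assume ?R
  then obtain j e where j: "Suc j < length fs" and gs: "gs = braid_act G fs [(j, e)]" by blast
  obtain xs f g ys where fs: "fs = xs @ f # g # ys" "length xs = j" using split_adjacent[OF j] .
  then have "braid_act G fs [(j, e)] =
      (if e then xs @ g # conj_by G f g # ys
       else xs @ (f \<otimes>\<^bsub>G\<^esub> g \<otimes>\<^bsub>G\<^esub> inv\<^bsub>G\<^esub> f) # f # ys)"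
    by (auto simp: braid_act_def hurwitz_sigma_append hurwitz_sigma_inv_append)
  then show ?L using fs gs by (auto intro: hurwitz_step.intros)
qed

lemma hurwitz_step_length: "hurwitz_step G fs gs \<Longrightarrow> length gs = length fs"
  by (induction rule: hurwitz_step.induct) auto

text \<open>A braid word is a path of single moves, its leftmost letter being the first move. Moves
  preserve the length of the tuple, so the range of admissible letters stays the same along the
  path.\<close>

lemma hurwitz_equivalent_iff: "hurwitz_equivalent G fs gs \<longleftrightarrow> (hurwitz_step G)\<^sup>*\<^sup>* fs gs"
proof
  have "(hurwitz_step G)\<^sup>*\<^sup>* fs (braid_act G fs \<beta>)"
    if "\<beta> \<in> words_over {j. Suc j < length fs}" for \<beta>
    using that
  proof (induction \<beta> arbitrary: fs)
    case Nil
    then show ?case by (simp add: braid_act_def)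
  next
    case (Cons l \<beta>)
    let ?fs = "braid_act G fs [l]"
    have step: "hurwitz_step G fs ?fs"
      using Cons.prems unfolding hurwitz_step_iff words_over_def by (cases l) auto
    moreover have "\<beta> \<in> words_over {j. Suc j < length ?fs}"
      using Cons.prems hurwitz_step_length[OF step] by (simp add: words_over_def)
    ultimately show ?case
      using Cons.IH[of ?fs] by (auto simp: braid_act_def intro: converse_rtranclp_into_rtranclp)
  qed
  then show "hurwitz_equivalent G fs gs \<Longrightarrow> (hurwitz_step G)\<^sup>*\<^sup>* fs gs"
    by (auto simp: hurwitz_equivalent_def)
next
  assume "(hurwitz_step G)\<^sup>*\<^sup>* fs gs"
  then show "hurwitz_equivalent G fs gs"
  proof (induction rule: converse_rtranclp_induct)
    case base
    show ?case
      unfolding hurwitz_equivalent_def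
      by (intro bexI[of _ "[]"]) (auto simp: braid_act_def words_over_def)
  next
    case (step fs gs')
    obtain j e where "Suc j < length fs" "braid_act G fs [(j, e)] = gs'"
      using step(1) unfolding hurwitz_step_iff by blast
    moreover obtain \<beta> where "\<beta> \<in> words_over {j. Suc j < length gs'}" "braid_act G gs' \<beta> = gs"
      using step(3) unfolding hurwitz_equivalent_def by blast
    ultimately show ?case
      unfolding hurwitz_equivalent_def using hurwitz_step_length[OF step(1)]
      by (intro bexI[of _ "(j, e) # \<beta>"]) (auto simp: braid_act_def words_over_def)
  qed
qed

lemma hurwitz_step_context: "hurwitz_step G fs gs \<Longrightarrow> hurwitz_step G (us @ fs @ vs) (us @ gs @ vs)"
proof (induction rule: hurwitz_step.induct)
  case (sigma xs f g ys)
  show ?case using hurwitz_step.sigma[of G "us @ xs" f g "ys @ vs"] by simp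
next
  case (sigma_inv xs f g ys)
  show ?case using hurwitz_step.sigma_inv[of G "us @ xs" f g "ys @ vs"] by simp
qed

lemma hurwitz_steps_context:
  "(hurwitz_step G)\<^sup>*\<^sup>* fs gs \<Longrightarrow> (hurwitz_step G)\<^sup>*\<^sup>* (us @ fs @ vs) (us @ gs @ vs)"
  by (induction rule: rtranclp_induct) (auto intro: hurwitz_step_context rtranclp.rtrancl_into_rtrancl)

section \<open>Conjugation, reversibility and invariants of Hurwitz moves\<close>

context group
begin

lemma conj_by_closed [simp]:
  "a \<in> carrier G \<Longrightarrow> b \<in> carrier G \<Longrightarrow> conj_by G a b \<in> carrier G"
  by (simp add: conj_by_def)

lemma conj_by_one [simp]: "a \<in> carrier G \<Longrightarrow> conj_by G a \<one> = a"
  by (simp add: conj_by_def)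

lemma conj_by_conj_by:
  "a \<in> carrier G \<Longrightarrow> b \<in> carrier G \<Longrightarrow> c \<in> carrier G \<Longrightarrow>
    conj_by G (conj_by G a b) c = conj_by G a (b \<otimes> c)"
  by (simp add: conj_by_def inv_mult_group m_assoc)

lemma conj_by_inv_cancel [simp]:
  "a \<in> carrier G \<Longrightarrow> b \<in> carrier G \<Longrightarrow> conj_by G (conj_by G a b) (inv b) = a"
  "a \<in> carrier G \<Longrightarrow> b \<in> carrier G \<Longrightarrow> conj_by G (conj_by G a (inv b)) b = a"
  by (simp_all add: conj_by_conj_by)

lemma conj_by_mult:
  "a \<in> carrier G \<Longrightarrow> b \<in> carrier G \<Longrightarrow> c \<in> carrier G \<Longrightarrow>
    conj_by G (a \<otimes> b) c = conj_by G a c \<otimes> conj_by G b c"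
  by (simp add: conj_by_def m_assoc) (simp add: m_assoc[symmetric])

lemma conj_by_hom: "c \<in> carrier G \<Longrightarrow> (\<lambda>a. conj_by G a c) \<in> hom G G"
  by (simp add: hom_def conj_by_mult)

lemma group_prod_closed: "set xs \<subseteq> carrier G \<Longrightarrow> group_prod G xs \<in> carrier G"
  by (induction xs) (auto simp: group_prod_def)

lemma group_prod_Cons [simp]: "group_prod G (x # xs) = x \<otimes> group_prod G xs"
  by (simp add: group_prod_def)

lemma group_prod_Nil [simp]: "group_prod G [] = \<one>"
  by (simp add: group_prod_def)

lemma group_prod_conj_by:
  "set xs \<subseteq> carrier G \<Longrightarrow> c \<in> carrier G \<Longrightarrow>
    group_prod G (map (\<lambda>x. conj_by G x c) xs) = conj_by G (group_prod G xs) c"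
  by (induction xs) (auto simp: group_prod_closed conj_by_mult, simp add: conj_by_def)

text \<open>\<open>sigma\<close> and \<open>sigma_inv\<close> at the same position undo each other,
  by cancellation among group elements.\<close>

lemma hurwitz_step_sym:
  assumes "hurwitz_step G fs gs" "set fs \<subseteq> carrier G"
  shows "hurwitz_step G gs fs"
  using assms
proof cases
  case (sigma xs f g ys)
  then have "g \<otimes> conj_by G f g \<otimes> inv g = f"
    using assms(2) by (simp add: conj_by_def m_assoc) (simp add: m_assoc[symmetric])
  then show ?thesis using sigma hurwitz_step.sigma_inv[of G xs g "conj_by G f g" ys] by simp
next
  case (sigma_inv xs f g ys)
  then have "conj_by G (f \<otimes> g \<otimes> inv f) f = g"
    using assms(2) by (simp add: conj_by_def m_assoc) (simp add: m_assoc[symmetric])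
  then show ?thesis using sigma_inv hurwitz_step.sigma[of G xs "f \<otimes> g \<otimes> inv f" f ys] by simp
qed

text \<open>A move alters one entry only, conjugating it by its neighbour or the inverse of its
  neighbour. So a subgroup containing the entries also contains all conjugators. Positions are not
  traced; another invariant has to identify where an entry ends up.\<close>

lemma hurwitz_step_conjugates:
  assumes "hurwitz_step G fs gs" "subgroup K G" "set fs \<subseteq> K"
  shows "set gs \<subseteq> K \<and> (\<forall>f \<in> set fs. \<exists>k \<in> K. conj_by G f k \<in> set gs)"
  using assms(1)
proof cases
  case (sigma xs f g ys)
  have K: "set xs \<subseteq> K" "f \<in> K" "g \<in> K" "set ys \<subseteq> K" using sigma assms(3) by auto
  have "conj_by G f g \<in> K"
    using K assms(2) by (simp add: conj_by_def subgroup.m_closed subgroup.m_inv_closed)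
  moreover have "\<exists>k \<in> K. conj_by G x k \<in> set gs" if "x \<in> set fs" for x
  proof (cases "x = f")
    case True
    then show ?thesis using sigma K by auto
  next
    case False
    have "x \<in> carrier G" using that assms(3) subgroup.subset[OF assms(2)] by blast
    then show ?thesis
      using that sigma False assms(2)
      by (intro bexI[of _ \<one>]) (auto simp: subgroup.one_closed)
  qed
  ultimately show ?thesis using sigma K by auto
next
  case (sigma_inv xs f g ys)
  have K: "set xs \<subseteq> K" "f \<in> K" "g \<in> K" "set ys \<subseteq> K" using sigma_inv assms(3) by auto
  have c: "f \<in> carrier G" "g \<in> carrier G" using K subgroup.subset[OF assms(2)] by blast+
  have "f \<otimes> g \<otimes> inv f \<in> K"
    using K assms(2) by (simp add: subgroup.m_closed subgroup.m_inv_closed)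
  moreover have "\<exists>k \<in> K. conj_by G x k \<in> set gs" if "x \<in> set fs" for x
  proof (cases "x = g")
    case True
    have "conj_by G g (inv f) = f \<otimes> g \<otimes> inv f" using c by (simp add: conj_by_def)
    then show ?thesis
      using True sigma_inv K assms(2) by (intro bexI[of _ "inv f"]) (auto simp: subgroup.m_inv_closed)
  next
    case False
    have "x \<in> carrier G" using that assms(3) subgroup.subset[OF assms(2)] by blast
    then show ?thesis
      using that sigma_inv False assms(2)
      by (intro bexI[of _ \<one>]) (auto simp: subgroup.one_closed)
  qed
  ultimately show ?thesis using sigma_inv K by auto
qed

lemma hurwitz_steps_conjugates:
  assumes "(hurwitz_step G)\<^sup>*\<^sup>* fs gs" "subgroup K G" "set fs \<subseteq> K"
  shows "set gs \<subseteq> K \<and> (\<forall>f \<in> set fs. \<exists>k \<in> K. conj_by G f k \<in> set gs)"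
  using assms(1)
proof (induction rule: rtranclp_induct)
  case base
  have "conj_by G f \<one> = f" if "f \<in> set fs" for f
    using that assms(3) subgroup.subset[OF assms(2)] by (intro conj_by_one) blast
  then show ?case using assms(2,3) by (metis subgroup.one_closed)
next
  case (step gs hs)
  have hs: "set hs \<subseteq> K" "\<forall>f \<in> set gs. \<exists>k \<in> K. conj_by G f k \<in> set hs"
    using hurwitz_step_conjugates[OF step(2) assms(2)] step.IH by auto
  have "\<exists>k \<in> K. conj_by G f k \<in> set hs" if f: "f \<in> set fs" for f
  proof -
    obtain k where k: "k \<in> K" "conj_by G f k \<in> set gs"
      using step.IH[THEN conjunct2, THEN bspec, OF f] by blast
    obtain l where l: "l \<in> K" "conj_by G (conj_by G f k) l \<in> set hs"
      using hs(2)[THEN bspec, OF k(2)] by blast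
    have "f \<in> carrier G" "k \<in> carrier G" "l \<in> carrier G"
      using f k l assms(3) subgroup.subset[OF assms(2)] by blast+
    then show ?thesis using k l assms(2) by (metis conj_by_conj_by subgroup.m_closed)
  qed
  then show ?case using hs(1) by blast
qed

lemma hurwitz_steps_sym:
  assumes "(hurwitz_step G)\<^sup>*\<^sup>* fs gs" "set fs \<subseteq> carrier G"
  shows "(hurwitz_step G)\<^sup>*\<^sup>* gs fs"
  using assms(1)
proof (induction rule: rtranclp_induct)
  case (step gs hs)
  have "set gs \<subseteq> carrier G"
    using hurwitz_steps_conjugates[OF step(1) subgroup_self assms(2)] by blast
  then show ?case using step hurwitz_step_sym by (meson converse_rtranclp_into_rtranclp)
qed simp

section \<open>Moving entries past each other and conjugating a block of product one\<close>

lemma hurwitz_pass_left: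
  "(hurwitz_step G)\<^sup>*\<^sup>* (xs @ [g]) (g # map (\<lambda>x. conj_by G x g) xs)"
proof (induction xs rule: rev_induct)
  case (snoc x xs)
  have "hurwitz_step G ((xs @ [x]) @ [g]) (xs @ [g, conj_by G x g])"
    using hurwitz_step.sigma[of G xs x g "[]"] by simp
  moreover have "(hurwitz_step G)\<^sup>*\<^sup>* (xs @ [g, conj_by G x g])
      (g # map (\<lambda>x. conj_by G x g) (xs @ [x]))"
    using hurwitz_steps_context[OF snoc, of "[]" "[conj_by G x g]"] by simp
  ultimately show ?case by (rule converse_rtranclp_into_rtranclp)
qed simp

text \<open>Only the moving entry changes: each \<open>sigma\<close> conjugates it by the entry it
  passes, and these conjugations compose to conjugation by the product.\<close>

lemma hurwitz_pass_right:
  assumes "g \<in> carrier G" "set xs \<subseteq> carrier G"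
  shows "(hurwitz_step G)\<^sup>*\<^sup>* (g # xs) (xs @ [conj_by G g (group_prod G xs)])"
  using assms
proof (induction xs arbitrary: g)
  case (Cons x xs)
  have "hurwitz_step G (g # x # xs) ([x] @ (conj_by G g x # xs) @ [])"
    using hurwitz_step.sigma[of G "[]" g x xs] by simp
  moreover have "(hurwitz_step G)\<^sup>*\<^sup>* ([x] @ (conj_by G g x # xs) @ [])
      ([x] @ (xs @ [conj_by G (conj_by G g x) (group_prod G xs)]) @ [])"
    using Cons by (intro hurwitz_steps_context Cons.IH) auto
  moreover have "conj_by G (conj_by G g x) (group_prod G xs) = conj_by G g (group_prod G (x # xs))"
    using Cons.prems by (simp add: conj_by_conj_by group_prod_closed)
  ultimately show ?case by (simp add: converse_rtranclp_into_rtranclp)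
qed simp

text \<open>An entry crossing \<open>C\<close> to the right is conjugated by the product of
  \<open>C\<close>, which is the identity, so nothing changes but the order.\<close>

lemma hurwitz_block_swap:
  assumes "set ps \<subseteq> carrier G" "set C \<subseteq> carrier G" "group_prod G C = \<one>"
  shows "(hurwitz_step G)\<^sup>*\<^sup>* (ps @ C) (C @ ps)"
  using assms(1)
proof (induction ps)
  case (Cons p ps)
  have "(hurwitz_step G)\<^sup>*\<^sup>* ([p] @ (ps @ C) @ []) ([p] @ (C @ ps) @ [])"
    using Cons by (intro hurwitz_steps_context) auto
  moreover have "(hurwitz_step G)\<^sup>*\<^sup>* ([] @ (p # C) @ ps) ([] @ (C @ [p]) @ ps)"
    using hurwitz_pass_right[of p C] Cons.prems assms by (intro hurwitz_steps_context) auto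
  ultimately show ?case by simp
qed simp

text \<open>The round trip of \<open>g\<close> over the block is asymmetric: going right conjugates
  \<open>g\<close> by the trivial product, coming back left conjugates each entry of the block by
  \<open>g\<close>.\<close>

lemma hurwitz_block_conj_member:
  assumes "set ps \<subseteq> carrier G" "set C \<subseteq> carrier G" "group_prod G C = \<one>" "g \<in> set ps"
  shows "(hurwitz_step G)\<^sup>*\<^sup>* (ps @ C) (ps @ map (\<lambda>x. conj_by G x g) C)"
proof -
  obtain us vs where ps: "ps = us @ g # vs" using assms(4) by (meson split_list)
  let ?D = "map (\<lambda>x. conj_by G x g) C"
  have g: "g \<in> carrier G" and vs: "set vs \<subseteq> carrier G" using assms(1) ps by auto
  have D: "set ?D \<subseteq> carrier G" using assms(2) g by auto
  have D1: "group_prod G ?D = \<one>"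
    using group_prod_conj_by[OF assms(2) g] assms(3) g by (simp add: conj_by_def)
  \<comment> \<open>The block is first brought next to \<open>g\<close>.\<close>
  have "(hurwitz_step G)\<^sup>*\<^sup>* (vs @ C) (C @ vs)"
    using vs assms by (intro hurwitz_block_swap)
  from hurwitz_steps_context[OF this, of "us @ [g]" "[]"]
  have 1: "(hurwitz_step G)\<^sup>*\<^sup>* (ps @ C) (us @ g # C @ vs)" using ps by simp
  have "(hurwitz_step G)\<^sup>*\<^sup>* (g # C) (C @ [g])"
    using hurwitz_pass_right[OF g assms(2)] assms(3) g by simp
  from rtranclp_trans[OF this hurwitz_pass_left]
  have 2: "(hurwitz_step G)\<^sup>*\<^sup>* (us @ g # C @ vs) (us @ g # ?D @ vs)"
    using hurwitz_steps_context[of G "g # C" "g # ?D" us vs] by simp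
  \<comment> \<open>The conjugated block still has product one, so the swap applies to it, here in
    reverse.\<close>
  have "(hurwitz_step G)\<^sup>*\<^sup>* (?D @ vs) (vs @ ?D)"
    using hurwitz_steps_sym[OF hurwitz_block_swap[OF vs D D1]] vs D by simp
  from hurwitz_steps_context[OF this, of "us @ [g]" "[]"]
  have 3: "(hurwitz_step G)\<^sup>*\<^sup>* (us @ g # ?D @ vs) (ps @ ?D)" using ps by simp
  show ?thesis using 1 2 3 by (meson rtranclp_trans)
qed

text \<open>Conjugation is a right action and keeps the product of the block trivial, so round trips
  over members of \<open>ps\<close> can be chained along any product of them.\<close>

lemma hurwitz_block_conj:
  assumes ps: "set ps \<subseteq> carrier G" and "k \<in> generate G (set ps)"
    and "set C \<subseteq> carrier G" "group_prod G C = \<one>"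
  shows "(hurwitz_step G)\<^sup>*\<^sup>* (ps @ C) (ps @ map (\<lambda>x. conj_by G x k) C)"
  using assms(2-4)
proof (induction arbitrary: C rule: generate.induct)
  case one
  have "map (\<lambda>x. conj_by G x \<one>) C = C" using one by (intro map_idI) auto
  then show ?case by simp
next
  case (incl h)
  then show ?case using ps by (intro hurwitz_block_conj_member) auto
next
  case (inv h)
  \<comment> \<open>Conjugating this block by \<open>h\<close> gives back \<open>C\<close>; the path
    from it to \<open>C\<close> is then reversed.\<close>
  let ?D = "map (\<lambda>x. conj_by G x (inv h)) C"
  have h: "h \<in> carrier G" using inv ps by auto
  have D: "set ?D \<subseteq> carrier G" using inv h by auto
  have "group_prod G ?D = \<one>"
    using group_prod_conj_by[OF inv(2), of "inv h"] inv h by (simp add: conj_by_def)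
  from hurwitz_block_conj_member[OF ps D this inv(1)]
  have "(hurwitz_step G)\<^sup>*\<^sup>* (ps @ ?D) (ps @ map (\<lambda>x. conj_by G x h) ?D)" .
  moreover have "map (\<lambda>x. conj_by G x h) ?D = C"
    using inv h by (auto simp: subset_iff intro!: map_idI)
  ultimately show ?case using hurwitz_steps_sym[of "ps @ ?D" "ps @ C"] ps D by simp
next
  case (eng k l)
  let ?D = "map (\<lambda>x. conj_by G x k) C"
  have kl: "k \<in> carrier G" "l \<in> carrier G" using eng(1,2) generate_in_carrier[OF ps] by auto
  have D: "set ?D \<subseteq> carrier G" using eng kl by auto
  have D1: "group_prod G ?D = \<one>"
    using group_prod_conj_by[of C k] eng kl by (simp add: conj_by_def)
  have eq: "map (\<lambda>x. conj_by G x l) ?D = map (\<lambda>x. conj_by G x (k \<otimes> l)) C"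
    using eng.prems kl by (auto simp: conj_by_conj_by subset_iff)
  show ?case
    using rtranclp_trans[OF eng.IH(1)[OF eng.prems] eng.IH(2)[OF D D1]] by (simp only: eq)
qed

end

section \<open>Hurwitz moves and homomorphisms\<close>

lemma hurwitz_step_map:
  assumes "group G" "group H" "h \<in> hom G H" "hurwitz_step G fs gs" "set fs \<subseteq> carrier G"
  shows "hurwitz_step H (map h fs) (map h gs)"
proof -
  interpret group_hom G H h using assms by (simp add: group_hom_def group_hom_axioms_def)
  show ?thesis
    using assms(4)
  proof cases
    case (sigma xs f g ys)
    then show ?thesis
      using assms(5) hurwitz_step.sigma[of H "map h xs" "h f" "h g" "map h ys"]
      by (simp add: conj_by_def)
  next
    case (sigma_inv xs f g ys)
    then show ?thesis
      using assms(5) hurwitz_step.sigma_inv[of H "map h xs" "h f" "h g" "map h ys"] by simp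
  qed
qed

text \<open>A move is fixed by its position and direction, so the same move performed on the
  preimage tuple lies over the given one.\<close>

lemma hurwitz_step_map_lift:
  assumes "group G" "group H" "h \<in> hom G H" "hurwitz_step H (map h fs) gs'" "set fs \<subseteq> carrier G"
  obtains gs where "hurwitz_step G fs gs" "gs' = map h gs"
proof -
  interpret group_hom G H h using assms by (simp add: group_hom_def group_hom_axioms_def)
  show ?thesis
    using assms(4)
  proof cases
    case (sigma xs f g ys)
    then obtain us u v vs where fs: "fs = us @ u # v # vs"
      "xs = map h us" "f = h u" "g = h v" "ys = map h vs"
      by (auto simp: map_eq_append_conv map_eq_Cons_conv)
    show ?thesis
    proof (rule that)
      show "hurwitz_step G fs (us @ v # conj_by G u v # vs)"
        unfolding fs(1) by (rule hurwitz_step.sigma)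
      show "gs' = map h (us @ v # conj_by G u v # vs)"
        using assms(5) sigma fs by (simp add: conj_by_def)
    qed
  next
    case (sigma_inv xs f g ys)
    then obtain us u v vs where fs: "fs = us @ u # v # vs"
      "xs = map h us" "f = h u" "g = h v" "ys = map h vs"
      by (auto simp: map_eq_append_conv map_eq_Cons_conv)
    show ?thesis
    proof (rule that)
      show "hurwitz_step G fs (us @ (u \<otimes>\<^bsub>G\<^esub> v \<otimes>\<^bsub>G\<^esub> inv\<^bsub>G\<^esub> u) # u # vs)"
        unfolding fs(1) by (rule hurwitz_step.sigma_inv)
      show "gs' = map h (us @ (u \<otimes>\<^bsub>G\<^esub> v \<otimes>\<^bsub>G\<^esub> inv\<^bsub>G\<^esub> u) # u # vs)"
        using assms(5) sigma_inv fs by simp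
    qed
  qed
qed

text \<open>A path in \<open>H\<close> lifts step by step. The lifted endpoint and \<open>gs\<close>
  have the same image, and injectivity makes them equal. This removes the embedding \<open>i\<close>
  and leaves a product with visible coordinates.\<close>

lemma hurwitz_steps_mon:
  assumes "group G" "group H" "h \<in> mon G H" "set fs \<subseteq> carrier G" "set gs \<subseteq> carrier G"
  shows "(hurwitz_step H)\<^sup>*\<^sup>* (map h fs) (map h gs) \<longleftrightarrow> (hurwitz_step G)\<^sup>*\<^sup>* fs gs"
proof
  have hom: "h \<in> hom G H" and inj: "inj_on h (carrier G)" using assms(3) by (auto simp: mon_def)
  have carr: "set ks \<subseteq> carrier G" if "(hurwitz_step G)\<^sup>*\<^sup>* fs ks" for ks
    using group.hurwitz_steps_conjugates[OF assms(1) that group.subgroup_self[OF assms(1)] assms(4)]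
    by blast
  have lift: "\<exists>ks. (hurwitz_step G)\<^sup>*\<^sup>* fs ks \<and> gs' = map h ks"
    if "(hurwitz_step H)\<^sup>*\<^sup>* (map h fs) gs'" for gs'
    using that
  proof (induction rule: rtranclp_induct)
    case (step ls ms)
    then obtain ks where ks: "(hurwitz_step G)\<^sup>*\<^sup>* fs ks" "ls = map h ks" by blast
    then show ?case
      using step(2) hurwitz_step_map_lift[OF assms(1,2) hom _ carr[OF ks(1)]]
      by (metis rtranclp.rtrancl_into_rtrancl)
  qed auto
  show "(hurwitz_step G)\<^sup>*\<^sup>* fs gs" if steps: "(hurwitz_step H)\<^sup>*\<^sup>* (map h fs) (map h gs)"
  proof -
    obtain ks where ks: "(hurwitz_step G)\<^sup>*\<^sup>* fs ks" "map h gs = map h ks" using lift[OF steps] by blast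
    have "gs = ks"
      using map_inj_on[OF ks(2)] inj assms(5) carr[OF ks(1)] by (meson Un_least inj_on_subset)
    then show ?thesis using ks(1) by simp
  qed
  show "(hurwitz_step H)\<^sup>*\<^sup>* (map h fs) (map h gs)" if "(hurwitz_step G)\<^sup>*\<^sup>* fs gs"
    using that
  proof (induction rule: rtranclp_induct)
    case (step ks ls)
    then show ?case
      using hurwitz_step_map[OF assms(1,2) hom step(2) carr[OF step(1)]]
      by (meson rtranclp.rtrancl_into_rtrancl)
  qed simp
qed

section \<open>Free groups\<close>

lemma carrier_free_group: "carrier (free_group S) = {w. w \<in> words_over S \<and> reduced w}"
  by (auto simp: free_group_def)

lemma mult_free_group: "u \<otimes>\<^bsub>free_group S\<^esub> v = foldr cons_red u v"
  by (simp add: free_group_def)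

lemma one_free_group: "\<one>\<^bsub>free_group S\<^esub> = []"
  by (simp add: free_group_def)

lemma free_gen_closed [simp]: "x \<in> S \<Longrightarrow> free_gen x \<in> carrier (free_group S)"
  by (simp add: carrier_free_group free_gen_def words_over_def)

lemma reduced_append:
  "reduced (u @ v) \<longleftrightarrow> reduced u \<and> reduced v \<and> (u = [] \<or> v = [] \<or> hd v \<noteq> flip (last u))"
proof (induction u rule: reduced.induct)
  case ("2_2" l)
  then show ?case by (cases v) auto
qed auto

lemma reduced_rev_flip: "reduced (rev (map flip u)) \<longleftrightarrow> reduced u"
proof (induction u rule: reduced.induct)
  case (1 l l' w)
  have "last (rev (map flip w) @ [flip l']) = flip l'" by simp
  then show ?case using 1 by (auto simp: reduced_append)
qed auto

lemma foldr_cons_red_append: "reduced (u @ v) \<Longrightarrow> foldr cons_red u v = u @ v"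
proof (induction u)
  case (Cons l u)
  then show ?case using reduced_tl[of l "u @ v"] cons_red_reduced[of l "u @ v"] by simp
qed simp

lemma length_cons_red: "length (cons_red l w) \<le> Suc (length w)"
  by (cases w) auto

lemma length_foldr_cons_red: "length (foldr cons_red u v) \<le> length u + length v"
  by (induction u) (auto intro: order_trans[OF length_cons_red])

text \<open>Every cancellation costs two letters, so a product of full length involves none. This
  turns an equation between group products into one between plain words.\<close>

lemma foldr_cons_red_full_length:
  "length (foldr cons_red u v) = length u + length v \<Longrightarrow> foldr cons_red u v = u @ v"
proof (induction u)
  case (Cons l u)
  have "length (foldr cons_red u v) = length u + length v"
    using Cons.prems length_cons_red[of l "foldr cons_red u v"] length_foldr_cons_red[of u v] by simp
  then show ?case using Cons by (cases "u @ v") (auto split: if_splits)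
qed simp

lemma inv_free_group:
  assumes "u \<in> carrier (free_group S)"
  shows "inv\<^bsub>free_group S\<^esub> u = rev (map flip u)"
proof -
  interpret group "free_group S" by (rule group_free_group)
  have "rev (map flip u) \<in> words_over S"
    using assms by (fastforce simp: carrier_free_group words_over_def)
  then have "rev (map flip u) \<in> carrier (free_group S)"
    using assms by (simp add: carrier_free_group reduced_rev_flip)
  moreover have "rev (map flip u) \<otimes>\<^bsub>free_group S\<^esub> u = \<one>\<^bsub>free_group S\<^esub>"
    using assms foldr_inverse_word[of "[]" u]
    by (simp add: mult_free_group one_free_group carrier_free_group foldr_cons_red_Nil)
  ultimately show ?thesis using assms inv_equality by blast
qed

section \<open>Evaluation of words and the universal property of free groups\<close>

lemma word_val_Nil [simp]: "word_val G g [] = \<one>\<^bsub>G\<^esub>"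
  by (simp add: word_val_def group_prod_def)

lemma word_val_Cons:
  "word_val G g ((x, e) # w) = (if e then g x else inv\<^bsub>G\<^esub> g x) \<otimes>\<^bsub>G\<^esub> word_val G g w"
  by (simp add: word_val_def group_prod_def)

lemma words_over_Nil [simp]: "[] \<in> words_over S"
  by (simp add: words_over_def)

lemma words_over_Cons [simp]: "(x, e) # w \<in> words_over S \<longleftrightarrow> x \<in> S \<and> w \<in> words_over S"
  by (simp add: words_over_def)

context group
begin

lemma word_val_closed:
  "g \<in> S \<rightarrow> carrier G \<Longrightarrow> w \<in> words_over S \<Longrightarrow> word_val G g w \<in> carrier G"
proof (induction w)
  case (Cons l w)
  then show ?case by (cases l) (auto simp: word_val_Cons)
qed simp

lemma word_val_cons_red:
  assumes "g \<in> S \<rightarrow> carrier G" "(x, e) # w \<in> words_over S"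
  shows "word_val G g (cons_red (x, e) w) = word_val G g ((x, e) # w)"
proof (cases w)
  case (Cons l w')
  obtain y d where l: "l = (y, d)" by (cases l)
  have c: "g x \<in> carrier G" "g y \<in> carrier G" "word_val G g w' \<in> carrier G"
    using assms Cons l word_val_closed[OF assms(1), of w'] by auto
  then show ?thesis
    using Cons l by (auto simp: word_val_Cons m_assoc[symmetric])
qed simp

lemma word_val_foldr_cons_red:
  assumes "g \<in> S \<rightarrow> carrier G" "u \<in> words_over S" "v \<in> words_over S"
  shows "word_val G g (foldr cons_red u v) = word_val G g u \<otimes> word_val G g v"
  using assms(2)
proof (induction u)
  case Nil
  then show ?case using word_val_closed[OF assms(1,3)] by simp
next
  case (Cons l u)
  obtain x e where l: "l = (x, e)" by (cases l)
  have u: "x \<in> S" "u \<in> words_over S" using Cons.prems l by auto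
  have "g x \<in> carrier G" using u assms(1) by auto
  then show ?case
    using l u Cons.IH word_val_cons_red[OF assms(1), of x e "foldr cons_red u v"]
      words_over_foldr[OF u(2) assms(3)] word_val_closed[OF assms(1)] assms(3)
    by (simp add: word_val_Cons m_assoc)
qed

text \<open>The existence half of the universal property. It supplies the exponent sums and the map
  from \<open>Fr (Suc n)\<close> to the quotient of \<open>Fr n\<close>.\<close>

lemma word_val_hom: "g \<in> S \<rightarrow> carrier G \<Longrightarrow> word_val G g \<in> hom (free_group S) G"
  by (auto simp: hom_def carrier_free_group mult_free_group word_val_closed word_val_foldr_cons_red)

lemma word_val_free_gen: "g x \<in> carrier G \<Longrightarrow> word_val G g (free_gen x) = g x"
  by (simp add: free_gen_def word_val_Cons)

lemma word_val_subgroup: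
  assumes "subgroup K G" "g \<in> S \<rightarrow> K" "w \<in> words_over S"
  shows "word_val G g w \<in> K"
  using assms(3)
proof (induction w)
  case Nil
  then show ?case using assms(1) by (simp add: subgroup.one_closed)
next
  case (Cons l w)
  obtain x e where l: "l = (x, e)" by (cases l)
  then have "g x \<in> K" "word_val G g w \<in> K" using Cons assms(2) by auto
  then show ?case
    using l assms(1) by (simp add: word_val_Cons subgroup.m_closed subgroup.m_inv_closed)
qed

end

lemma (in group_hom) hom_word_val:
  assumes "g \<in> S \<rightarrow> carrier G" "w \<in> words_over S"
  shows "h (word_val G g w) = word_val H (\<lambda>x. h (g x)) w"
  using assms(2)
proof (induction w)
  case (Cons l w)
  obtain x e where l: "l = (x, e)" by (cases l)
  then have "g x \<in> carrier G" "word_val G g w \<in> carrier G"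
    using Cons.prems assms(1) G.word_val_closed[OF assms(1)] by auto
  then show ?case using Cons l by (simp add: word_val_Cons)
qed simp

text \<open>Letters are prepended one at a time, and none cancels because every suffix of a reduced
  word is reduced.\<close>

lemma free_word_reduced:
  assumes "w \<in> carrier (free_group S)"
  shows "free_word S w = w"
  using assms
proof (induction w)
  case Nil
  then show ?case by (simp add: free_word_def one_free_group)
next
  case (Cons l w)
  obtain x e where l: "l = (x, e)" by (cases l)
  then have w: "w \<in> carrier (free_group S)" "x \<in> S" "reduced (l # w)"
    using Cons.prems reduced_tl by (auto simp: carrier_free_group)
  have "inv\<^bsub>free_group S\<^esub> free_gen x = [(x, False)]"
    using inv_free_group[OF free_gen_closed[OF w(2)]] by (simp add: free_gen_def)
  then have "free_word S (l # w) = [l] \<otimes>\<^bsub>free_group S\<^esub> free_word S w"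
    using l by (simp add: free_word_def word_val_Cons free_gen_def)
  also have "\<dots> = l # w"
    using Cons.IH[OF w(1)] cons_red_reduced[OF w(3)] by (simp add: mult_free_group)
  finally show ?case .
qed

lemma free_word_closed: "w \<in> words_over S \<Longrightarrow> free_word S w \<in> carrier (free_group S)"
  unfolding free_word_def by (rule group.word_val_closed[OF group_free_group]) auto

text \<open>An element is the value of its own spelling at the free generators, and a subgroup
  containing the generators contains such values.\<close>

lemma free_group_subgroup_eq:
  assumes "subgroup K (free_group S)" "\<And>x. x \<in> S \<Longrightarrow> free_gen x \<in> K"
  shows "carrier (free_group S) \<subseteq> K"
proof
  fix w assume w: "w \<in> carrier (free_group S)"
  then have "free_word S w \<in> K"
    unfolding free_word_def
    using assms
    by (intro group.word_val_subgroup[OF group_free_group, where S = S]) (auto simp: carrier_free_group)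
  then show "w \<in> K" using free_word_reduced[OF w] by simp
qed

section \<open>Centralizers in free groups\<close>

text \<open>The hypothesis excludes cancellation between consecutive copies of \<open>z\<close>, so
  group powers and repetitions of plain words agree.\<close>

lemma pow_free_group_replicate:
  "reduced (concat (replicate k z)) \<Longrightarrow> z [^]\<^bsub>free_group S\<^esub> k = concat (replicate k z)"
proof (induction k)
  case 0
  then show ?case by (simp add: one_free_group)
next
  case (Suc k)
  have eq: "concat (replicate (Suc k) z) = concat (replicate k z) @ z"
    by (simp flip: replicate_append_same)
  then have "reduced (concat (replicate k z) @ z)" using Suc.prems by simp
  then show ?case
    unfolding eq using Suc.IH by (simp add: reduced_append mult_free_group foldr_cons_red_append)
qed

text \<open>If \<open>u\<close> is cyclically reduced, then \<open>v\<close> cannot cancel against both ends of \<open>u\<close>. So after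
  replacing \<open>u\<close> by its inverse if necessary, \<open>u\<close> and \<open>v\<close> commute as plain words, and commuting
  words are powers of a common word.\<close>

lemma commute_no_cancel:
  assumes u: "u \<in> carrier (free_group S)" "u \<noteq> []" and v: "v \<in> carrier (free_group S)"
    and "v = [] \<or> hd u \<noteq> flip (last v)"
    and comm: "u \<otimes>\<^bsub>free_group S\<^esub> v = v \<otimes>\<^bsub>free_group S\<^esub> u"
  shows "\<exists>z \<in> carrier (free_group S). \<exists>(k::nat) (l::nat).
    u = z [^]\<^bsub>free_group S\<^esub> k \<and> v = z [^]\<^bsub>free_group S\<^esub> l"
proof -
  have "reduced (v @ u)" using assms by (auto simp: reduced_append carrier_free_group)
  then have vu: "foldr cons_red v u = v @ u" by (rule foldr_cons_red_append)
  \<comment> \<open>By commutation this product equals \<open>v @ u\<close>, so it has full length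
    and is free of cancellation too.\<close>
  then have "foldr cons_red u v = u @ v"
    using comm by (intro foldr_cons_red_full_length) (simp add: mult_free_group)
  then have "u @ v = v @ u" using comm vu by (simp add: mult_free_group)
  then obtain k l z where z: "concat (replicate k z) = u" "concat (replicate l z) = v"
    using comm_append_are_replicate by blast
  \<comment> \<open>As \<open>u\<close> is nonempty, \<open>z\<close> is a prefix of it and inherits
    being reduced and spelled over \<open>S\<close>.\<close>
  then obtain k' where "k = Suc k'" using u(2) by (cases k) auto
  then have "u = z @ concat (replicate k' z)" using z(1) by simp
  then have "z \<in> carrier (free_group S)"
    using u(1) by (simp add: carrier_free_group words_over_def reduced_append)
  moreover have "u = z [^]\<^bsub>free_group S\<^esub> k" "v = z [^]\<^bsub>free_group S\<^esub> l"
    using z u(1) v pow_free_group_replicate[of k z S] pow_free_group_replicate[of l z S]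
    by (simp_all add: carrier_free_group)
  ultimately show ?thesis by blast
qed

text \<open>Replacing \<open>u\<close> by its inverse only changes the sign of an exponent, which is
  why the exponents become integers here.\<close>

lemma commute_cyclically_reduced:
  assumes u: "u \<in> carrier (free_group S)" "u \<noteq> []" "hd u \<noteq> flip (last u)"
    and v: "v \<in> carrier (free_group S)"
    and comm: "u \<otimes>\<^bsub>free_group S\<^esub> v = v \<otimes>\<^bsub>free_group S\<^esub> u"
  shows "\<exists>z \<in> carrier (free_group S). \<exists>(k::int) (l::int).
    u = z [^]\<^bsub>free_group S\<^esub> k \<and> v = z [^]\<^bsub>free_group S\<^esub> l"
proof (cases "v = [] \<or> hd u \<noteq> flip (last v)")
  case True
  then show ?thesis using commute_no_cancel[OF u(1,2) v _ comm] by (metis int_pow_int)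
next
  case False
  interpret group "free_group S" by (rule group_free_group)
  let ?u = "inv\<^bsub>free_group S\<^esub> u"
  have inv_u: "?u = rev (map flip u)" using u(1) by (rule inv_free_group)
  have "hd ?u = flip (last u)" using u(2) by (simp add: inv_u hd_rev last_map)
  \<comment> \<open>Otherwise \<open>u\<close> and \<open>v\<close> would have the same last letter,
    and the first letter of \<open>u\<close> would cancel against it, contrary to \<open>u\<close>
    being cyclically reduced.\<close>
  then have "hd ?u \<noteq> flip (last v)"
    using False u(3) by (metis flip_flip)
  moreover have "?u \<otimes>\<^bsub>free_group S\<^esub> v = v \<otimes>\<^bsub>free_group S\<^esub> ?u"
    using comm u(1) v by (metis inv_closed inv_solve_left inv_solve_right m_assoc m_closed)
  moreover have "?u \<in> carrier (free_group S)" using u(1) by (rule inv_closed)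
  moreover have "?u \<noteq> []" using u(2) by (simp add: inv_u)
  ultimately obtain z and k l :: nat where z: "z \<in> carrier (free_group S)"
      "?u = z [^]\<^bsub>free_group S\<^esub> k" "v = z [^]\<^bsub>free_group S\<^esub> l"
    using commute_no_cancel[of ?u S v] v by blast
  have "u = inv\<^bsub>free_group S\<^esub> (z [^]\<^bsub>free_group S\<^esub> k)"
    using z(2) u(1) by (metis inv_inv)
  then have "u = z [^]\<^bsub>free_group S\<^esub> (- int k)"
    using int_pow_neg_int[OF z(1)] by simp
  moreover have "v = z [^]\<^bsub>free_group S\<^esub> int l" using z(3) by (simp add: int_pow_int)
  ultimately show ?thesis using z(1) by blast
qed

lemma (in group) conj_by_int_pow:
  fixes k :: int
  assumes "a \<in> carrier G" "c \<in> carrier G"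
  shows "conj_by G (a [^] k) c = conj_by G a c [^] k"
  using hom_int_pow[OF conj_by_hom[OF assms(2)] assms(1) is_group is_group] .

text \<open>Induction on the length of \<open>u\<close>: if its two ends are inverse to each other,
  conjugation by the first letter removes both. Conjugation preserves commuting and powers, so the
  cyclically reduced case suffices.\<close>

theorem free_group_commute:
  assumes "u \<in> carrier (free_group S)" "v \<in> carrier (free_group S)"
    and "u \<otimes>\<^bsub>free_group S\<^esub> v = v \<otimes>\<^bsub>free_group S\<^esub> u"
  shows "\<exists>z \<in> carrier (free_group S). \<exists>(k::int) (l::int).
    u = z [^]\<^bsub>free_group S\<^esub> k \<and> v = z [^]\<^bsub>free_group S\<^esub> l"
  using assms
proof (induction "length u" arbitrary: u v rule: less_induct)
  case less
  interpret group "free_group S" by (rule group_free_group)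
  consider "u = []" | "u \<noteq> []" "hd u \<noteq> flip (last u)" | "u \<noteq> []" "hd u = flip (last u)" by blast
  then show ?case
  proof cases
    case 1
    then have "u = v [^]\<^bsub>free_group S\<^esub> (0::int)" by (simp add: one_free_group)
    moreover have "v = v [^]\<^bsub>free_group S\<^esub> (1::int)" using less by simp
    ultimately show ?thesis using less(3) by (intro bexI[of _ v] exI conjI)
  next
    case 2
    then show ?thesis using less commute_cyclically_reduced by blast
  next
    case 3
    let ?l = "last u"
    \<comment> \<open>A one-letter word has the same first and last letter, and no letter is its own
      flip.\<close>
    have "tl u \<noteq> []" using 3 by (cases u) auto
    then have u: "u = flip ?l # butlast (tl u) @ [?l]"
      using 3 by (cases u) auto
    define w where "w = butlast (tl u)"
    define c where "c = [flip ?l]"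
    have u': "u = c @ w @ [?l]" using u by (simp add: w_def c_def)
    have lS: "fst ?l \<in> S"
      using less(2) last_in_set[OF 3(1)]
      by (auto simp: carrier_free_group words_over_def in_lists_conv_set mem_Times_iff)
    have c: "c \<in> carrier (free_group S)"
      using lS by (cases ?l) (simp add: c_def carrier_free_group)
    have inv_c: "inv\<^bsub>free_group S\<^esub> c = [?l]"
      using inv_free_group[OF c] by (simp add: c_def)
    have red: "reduced (c @ w @ [?l])" using less(2) u' by (simp add: carrier_free_group)
    have "c @ w @ [?l] \<in> words_over S"
      using less(2) u'[symmetric] by (simp add: carrier_free_group)
    then have w: "w \<in> carrier (free_group S)"
      using red by (simp add: carrier_free_group words_over_def reduced_append)
    have "u = c \<otimes>\<^bsub>free_group S\<^esub> (w \<otimes>\<^bsub>free_group S\<^esub> inv\<^bsub>free_group S\<^esub> c)"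
    proof -
      have "reduced (w @ [?l])" using red reduced_append by blast
      then show ?thesis
        unfolding mult_free_group inv_c
        using foldr_cons_red_append[OF red] foldr_cons_red_append[of w "[?l]"] u' by simp
    qed
    then have uw: "conj_by (free_group S) u c = w"
      using w c by (simp add: conj_by_def m_assoc) (simp add: m_assoc[symmetric])
    let ?v = "conj_by (free_group S) v c"
    have "w \<otimes>\<^bsub>free_group S\<^esub> ?v = ?v \<otimes>\<^bsub>free_group S\<^esub> w"
      using less c by (simp add: uw[symmetric] conj_by_mult[symmetric])
    moreover have "length w < length u" using u' by (metis c_def length_Cons length_append lessI
        add_Suc_right list.size(3) add.right_neutral less_SucI plus_1_eq_Suc)
    ultimately obtain z and k l :: int where z: "z \<in> carrier (free_group S)"
        "w = z [^]\<^bsub>free_group S\<^esub> k" "?v = z [^]\<^bsub>free_group S\<^esub> l"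
      using less(1)[of w ?v] w c less(3) by auto
    \<comment> \<open>Undoing the conjugation carries the common base of \<open>w\<close> and
      \<open>?v\<close> to one of \<open>u\<close> and \<open>v\<close>.\<close>
    let ?z = "conj_by (free_group S) z (inv\<^bsub>free_group S\<^esub> c)"
    have "u = conj_by (free_group S) w (inv\<^bsub>free_group S\<^esub> c)"
      using uw less(2) c by auto
    moreover have "v = conj_by (free_group S) ?v (inv\<^bsub>free_group S\<^esub> c)"
      using less(3) c by auto
    ultimately have "u = ?z [^]\<^bsub>free_group S\<^esub> k" "v = ?z [^]\<^bsub>free_group S\<^esub> l"
      using z c by (simp_all add: conj_by_int_pow)
    then show ?thesis using z(1) c by (intro bexI[of _ ?z]) auto
  qed
qed

text \<open>Both elements are powers of some \<open>z\<close>; rootlessness makes \<open>h\<close>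
  equal to \<open>z\<close> or its inverse, so powers of \<open>z\<close> are powers of
  \<open>h\<close>.\<close>

corollary centralizer_no_root:
  assumes "h \<in> carrier (free_group S)" "has_no_root (free_group S) h" "g \<in> carrier (free_group S)"
    and "h \<otimes>\<^bsub>free_group S\<^esub> g = g \<otimes>\<^bsub>free_group S\<^esub> h"
  obtains k :: int where "g = h [^]\<^bsub>free_group S\<^esub> k"
proof -
  interpret group "free_group S" by (rule group_free_group)
  obtain z and k l :: int where z: "z \<in> carrier (free_group S)"
      "h = z [^]\<^bsub>free_group S\<^esub> k" "g = z [^]\<^bsub>free_group S\<^esub> l"
    using free_group_commute[OF assms(1,3,4)] by blast
  \<comment> \<open>The exponent 0 is excluded as well, so \<open>h\<close> is nontrivial; the
    centralizer of the identity would be the whole group.\<close>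
  then have "k = 1 \<or> k = -1" using assms(2) unfolding has_no_root_def by blast
  then have "z = h [^]\<^bsub>free_group S\<^esub> k"
    using z(1,2) by (auto simp: int_pow_neg)
  then have "g = h [^]\<^bsub>free_group S\<^esub> (k * l)"
    using z(3) assms(1) by (simp add: int_pow_pow)
  then show thesis by (rule that)
qed

section \<open>Exponent sums\<close>

definition exponent_sum :: "'a \<Rightarrow> 'a word \<Rightarrow> int" where
  "exponent_sum x = word_val integer_group (\<lambda>y. if y = x then 1 else 0)"

lemma exponent_sum_hom: "exponent_sum x \<in> hom (free_group S) integer_group"
  unfolding exponent_sum_def by (rule group.word_val_hom) auto

lemma exponent_sum_free_gen: "exponent_sum x (free_gen y) = (if y = x then 1 else 0)"
  by (simp add: exponent_sum_def group.word_val_free_gen)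

lemma exponent_sum_inv:
  "w \<in> carrier (free_group S) \<Longrightarrow> exponent_sum x (inv\<^bsub>free_group S\<^esub> w) = - exponent_sum x w"
  using group_hom.hom_inv[of "free_group S" integer_group "exponent_sum x" w]
  by (simp add: group_hom_def group_hom_axioms_def group_free_group exponent_sum_hom)

lemma exponent_sum_mult:
  "v \<in> carrier (free_group S) \<Longrightarrow> w \<in> carrier (free_group S) \<Longrightarrow>
    exponent_sum x (v \<otimes>\<^bsub>free_group S\<^esub> w) = exponent_sum x v + exponent_sum x w"
  using hom_mult[OF exponent_sum_hom[of x S]] by simp

lemma exponent_sum_conj_by:
  assumes "v \<in> carrier (free_group S)" "w \<in> carrier (free_group S)"
  shows "exponent_sum x (conj_by (free_group S) v w) = exponent_sum x v"
proof -
  interpret group "free_group S" by (rule group_free_group)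
  show ?thesis using assms by (simp add: conj_by_def exponent_sum_mult exponent_sum_inv)
qed

text \<open>The exponent of \<open>x\<close> is 1 in \<open>free_gen x\<close> and a multiple of
  \<open>k\<close> in any \<open>k\<close>-th power, so \<open>k\<close> divides 1.\<close>

lemma has_no_root_free_gen: "has_no_root (free_group S) (free_gen x)"
  unfolding has_no_root_def
proof safe
  fix w and k :: int
  assume w: "w \<in> carrier (free_group S)" and k: "k \<noteq> 1" "k \<noteq> -1"
    and eq: "free_gen x = w [^]\<^bsub>free_group S\<^esub> k"
  have "1 = exponent_sum x (free_gen x)" by (simp add: exponent_sum_free_gen)
  also have "\<dots> = k * exponent_sum x w"
    unfolding eq
    using hom_int_pow[OF exponent_sum_hom w group_free_group group_integer_group] by simp
  finally have "k dvd 1" by (metis dvd_triv_left)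
  then show False using k by (auto simp: zdvd1_eq)
qed

section \<open>Subgroups of direct products\<close>

lemma conj_by_DirProd:
  assumes "group G" "group H" "a \<in> carrier G" "b \<in> carrier H" "c \<in> carrier G" "d \<in> carrier H"
  shows "conj_by (G \<times>\<times> H) (a, b) (c, d) = (conj_by G a c, conj_by H b d)"
  using assms by (simp add: conj_by_def)

text \<open>This is the fibre product of \<open>f\<close> and \<open>g\<close> over
  \<open>Q\<close>. It will hold the entries of the tuples and hence all conjugators.\<close>

lemma subgroup_equalizer:
  assumes "group_hom G Q f" "group_hom H Q g"
  shows "subgroup {(u, x). u \<in> carrier G \<and> x \<in> carrier H \<and> f u = g x} (G \<times>\<times> H)" (is "subgroup ?K _")
proof -
  interpret f: group_hom G Q f by fact
  interpret g: group_hom H Q g by fact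
  interpret D: group "G \<times>\<times> H" by (intro DirProd_group f.G.is_group g.G.is_group)
  show ?thesis
  proof (rule D.subgroupI)
    show "?K \<noteq> {}" using f.G.one_closed g.G.one_closed by fastforce
  qed auto
qed

text \<open>Any \<open>x\<close> in \<open>G\<close> lifts to some \<open>(x, y)\<close> in the
  generated subgroup. Conjugating \<open>(u, 1)\<close> by this lift stays in the subgroup and
  leaves the second coordinate trivial.\<close>

lemma normal_slice:
  assumes "group G" "group H" "A \<subseteq> carrier (G \<times>\<times> H)"
    and "carrier G \<subseteq> fst ` generate (G \<times>\<times> H) A"
  shows "{u. (u, \<one>\<^bsub>H\<^esub>) \<in> generate (G \<times>\<times> H) A} \<lhd> G" (is "?M \<lhd> G")
proof -
  interpret G: group G by fact
  interpret H: group H by fact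
  interpret D: group "G \<times>\<times> H" by (intro DirProd_group assms)
  note in_carrier = D.generate_in_carrier[OF assms(3)]
  note inv_gen = D.generate_m_inv_closed[OF assms(3)]
  have M: "?M \<subseteq> carrier G" using in_carrier by auto
  show ?thesis
    unfolding G.normal_inv_iff
  proof (intro conjI ballI)
    show "subgroup ?M G"
    proof (rule G.subgroupI)
      show "?M \<noteq> {}" using generate.one[of "G \<times>\<times> H" A] by auto
      show "inv\<^bsub>G\<^esub> u \<in> ?M" if "u \<in> ?M" for u
        using that inv_gen[of "(u, \<one>\<^bsub>H\<^esub>)"] M by auto
      show "u \<otimes>\<^bsub>G\<^esub> v \<in> ?M" if "u \<in> ?M" "v \<in> ?M" for u v
        using that generate.eng[of "(u, \<one>\<^bsub>H\<^esub>)" "G \<times>\<times> H" A "(v, \<one>\<^bsub>H\<^esub>)"] by auto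
    qed (rule M)
  next
    fix x u assume x: "x \<in> carrier G" and u: "u \<in> ?M"
    obtain y where y: "(x, y) \<in> generate (G \<times>\<times> H) A" using assms(4) x by force
    then have yc: "y \<in> carrier H" using in_carrier by auto
    have "(x, y) \<otimes>\<^bsub>G \<times>\<times> H\<^esub> (u, \<one>\<^bsub>H\<^esub>) \<otimes>\<^bsub>G \<times>\<times> H\<^esub> inv\<^bsub>G \<times>\<times> H\<^esub> (x, y) \<in> generate (G \<times>\<times> H) A"
      using y u inv_gen[OF y] by (intro generate.eng) auto
    then show "x \<otimes>\<^bsub>G\<^esub> u \<otimes>\<^bsub>G\<^esub> inv\<^bsub>G\<^esub> x \<in> ?M" using x yc assms(1,2) by simp
  qed
qed

lemma (in group_hom) hom_group_prod:
  "set xs \<subseteq> carrier G \<Longrightarrow> h (group_prod G xs) = group_prod H (map h xs)"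
  by (induction xs) (auto simp: G.group_prod_closed)

lemma (in group_hom) hom_eq_of_kernel:
  assumes "a \<in> carrier G" "u \<in> carrier G" "b \<in> carrier G"
    and "h u = \<one>\<^bsub>H\<^esub>" "h (a \<otimes> u \<otimes> inv b) = \<one>\<^bsub>H\<^esub>"
  shows "h a = h b"
  using assms H.inv_solve_right'[of "\<one>\<^bsub>H\<^esub>" "h a" "h b"] by simp

section \<open>The word problem and Hurwitz equivalence\<close>

declare One_nat_def [simp del] upt_Suc [simp del]

lemma normal_relator_closure:
  assumes "R \<subseteq> words_over S"
  shows "relator_closure S R \<lhd> free_group S"
  unfolding relator_closure_def
  using assms by (intro normal_normal_closure group_free_group) (auto intro: free_word_closed)

text \<open>The quotient map is a homomorphism and so commutes with evaluating words. Equality in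
  the presented group becomes equality of cosets.\<close>

lemma presented_word_eq_coset:
  assumes "R \<subseteq> words_over S" "w \<in> words_over S"
  shows "presented_word S R w = relator_closure S R #>\<^bsub>free_group S\<^esub> free_word S w"
proof -
  interpret N: normal "relator_closure S R" "free_group S"
    using assms(1) by (rule normal_relator_closure)
  interpret q: group_hom "free_group S" "presented_group S R"
      "\<lambda>u. relator_closure S R #>\<^bsub>free_group S\<^esub> u"
    unfolding presented_group_def
    by (simp add: group_hom_def group_hom_axioms_def group_free_group N.factorgroup_is_group
        N.r_coset_hom_Mod)
  show ?thesis
    using q.hom_word_val[of free_gen S w] assms(2) by (simp add: presented_word_def free_word_def)
qed

section \<open>The factorization as a fixed tuple followed by a test block\<close>

definition base_tuple :: "nat \<Rightarrow> nat word list \<Rightarrow> (nat word \<times> nat word) list" where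
  "base_tuple n vs =
     map (\<lambda>r. (r, \<one>\<^bsub>Fr (Suc n)\<^esub>)) (append_inv_prod (Fr n) vs) @
     zip (append_inv_prod (Fr n) (map free_gen [1..<Suc n]))
       (append_inv_prod (Fr (Suc n)) (map free_gen [1..<Suc n]))"

text \<open>Only this block depends on the word being tested; \<open>base_tuple\<close> is common to
  both sides of an equivalence.\<close>

definition test_block :: "nat \<Rightarrow> nat word \<Rightarrow> (nat word \<times> nat word) list" where
  "test_block n h =
     [(inv\<^bsub>Fr n\<^esub> h, inv\<^bsub>Fr (Suc n)\<^esub> (free_gen (Suc n))), (h, free_gen (Suc n))]"

lemma FTL_s1_eq: "FTL_s1 n Rs i h = map i (base_tuple n (V_list n Rs) @ test_block n h)"
  by (simp add: FTL_s1_def Let_def P_tuple_def base_tuple_def test_block_def append_inv_prod_def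
      nth_append zip_append2)

lemma set_base_tuple:
  "set (base_tuple n vs) =
     (\<lambda>v. (v, \<one>\<^bsub>Fr (Suc n)\<^esub>)) ` set vs \<union> {(inv\<^bsub>Fr n\<^esub> group_prod (Fr n) vs, \<one>\<^bsub>Fr (Suc n)\<^esub>)} \<union>
     (\<lambda>j. (free_gen j, free_gen j)) ` {1..n} \<union>
     {(inv\<^bsub>Fr n\<^esub> group_prod (Fr n) (map free_gen [1..<Suc n]),
       inv\<^bsub>Fr (Suc n)\<^esub> group_prod (Fr (Suc n)) (map free_gen [1..<Suc n]))}"
proof -
  have "zip (map free_gen [1..<Suc n]) (map free_gen [1..<Suc n]) =
      map (\<lambda>j. (free_gen j, free_gen j)) [1..<Suc n]"
    by (simp add: zip_map1 zip_map2 zip_same_conv_map)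
  then have "set (zip (map free_gen [1..<Suc n]) (map free_gen [1..<Suc n])) =
      (\<lambda>j. (free_gen j, free_gen j)) ` {1..n}"
    by (simp add: atLeastLessThanSuc_atLeastAtMost)
  then show ?thesis by (auto simp: base_tuple_def append_inv_prod_def)
qed

lemma free_gens_closed: "n \<le> m \<Longrightarrow> set (map free_gen [1..<Suc n]) \<subseteq> carrier (Fr m)"
  by auto

lemma base_tuple_closed:
  assumes "set vs \<subseteq> carrier (Fr n)"
  shows "set (base_tuple n vs) \<subseteq> carrier (Fr n \<times>\<times> Fr (Suc n))"
proof -
  interpret F: group "Fr n" by (rule group_free_group)
  interpret FX: group "Fr (Suc n)" by (rule group_free_group)
  show ?thesis
    unfolding set_base_tuple
    using assms F.group_prod_closed[OF assms] F.group_prod_closed[OF free_gens_closed[OF le_refl]]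
      FX.group_prod_closed[OF free_gens_closed[of n "Suc n"]]
    by auto
qed

lemma test_block_closed:
  "h \<in> carrier (Fr n) \<Longrightarrow> set (test_block n h) \<subseteq> carrier (Fr n \<times>\<times> Fr (Suc n))"
  by (auto simp: test_block_def group_free_group group.inv_closed)

lemma group_prod_test_block:
  assumes "h \<in> carrier (Fr n)"
  shows "group_prod (Fr n \<times>\<times> Fr (Suc n)) (test_block n h) = \<one>\<^bsub>Fr n \<times>\<times> Fr (Suc n)\<^esub>"
proof -
  interpret F: group "Fr n" by (rule group_free_group)
  interpret FX: group "Fr (Suc n)" by (rule group_free_group)
  show ?thesis using assms by (simp add: test_block_def group_prod_def)
qed

text \<open>The entries \<open>(free_gen j, free_gen j)\<close> make the generated subgroup project
  onto \<open>Fr n\<close>. Its slice is therefore normal, and it contains the relators because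
  these are paired with the identity.\<close>

lemma normal_closure_subset_slice:
  assumes "set vs \<subseteq> carrier (Fr n)"
  shows "normal_closure (Fr n) (set vs) \<subseteq>
    {u. (u, \<one>\<^bsub>Fr (Suc n)\<^esub>) \<in> generate (Fr n \<times>\<times> Fr (Suc n)) (set (base_tuple n vs))}" (is "_ \<subseteq> ?M")
proof -
  let ?D = "Fr n \<times>\<times> Fr (Suc n)" and ?A = "set (base_tuple n vs)"
  note grp = group_free_group[of "{1..n}"] group_free_group[of "{1..Suc n}"]
  interpret D: group ?D by (intro DirProd_group grp)
  have "group_hom ?D (Fr n) fst"
    using grp by (auto simp: group_hom_def group_hom_axioms_def hom_def mult_DirProd' D.is_group)
  then have "subgroup (fst ` generate ?D ?A) (Fr n)"
    by (rule group_hom.subgroup_img_is_subgroup) (rule D.generate_is_subgroup[OF base_tuple_closed[OF assms]])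
  moreover have "free_gen x \<in> fst ` generate ?D ?A" if "x \<in> {1..n}" for x
    using that by (intro image_eqI[of _ _ "(free_gen x, free_gen x)"] generate.incl)
      (auto simp: set_base_tuple)
  ultimately have "carrier (Fr n) \<subseteq> fst ` generate ?D ?A"
    by (rule free_group_subgroup_eq)
  then have "?M \<lhd> Fr n" by (intro normal_slice grp base_tuple_closed assms)
  moreover have "set vs \<subseteq> ?M" by (auto simp: set_base_tuple intro: generate.incl)
  ultimately show ?thesis unfolding normal_closure_def by blast
qed

text \<open>Conjugation by \<open>(u, 1)\<close> changes the first coordinates of the block and
  fixes the second ones, so the result is again a test block.\<close>

lemma hurwitz_steps_conj_normal_closure:
  assumes vs: "set vs \<subseteq> carrier (Fr n)" and h: "h \<in> carrier (Fr n)"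
    and u: "u \<in> normal_closure (Fr n) (set vs)"
  shows "(hurwitz_step (Fr n \<times>\<times> Fr (Suc n)))\<^sup>*\<^sup>* (base_tuple n vs @ test_block n h)
    (base_tuple n vs @ test_block n (conj_by (Fr n) h u))"
proof -
  let ?D = "Fr n \<times>\<times> Fr (Suc n)"
  interpret F: group "Fr n" by (rule group_free_group)
  interpret FX: group "Fr (Suc n)" by (rule group_free_group)
  interpret D: group ?D by (intro DirProd_group F.is_group FX.is_group)
  note closed = base_tuple_closed[OF vs]
  have k: "(u, \<one>\<^bsub>Fr (Suc n)\<^esub>) \<in> generate ?D (set (base_tuple n vs))"
    using normal_closure_subset_slice[OF vs] u by blast
  then have uc: "u \<in> carrier (Fr n)" using D.generate_in_carrier[OF closed] by fastforce
  have "conj_by (Fr n) (inv\<^bsub>Fr n\<^esub> h) u = inv\<^bsub>Fr n\<^esub> (conj_by (Fr n) h u)"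
    using h uc by (simp add: conj_by_def F.inv_mult_group F.m_assoc)
  then have "map (\<lambda>x. conj_by ?D x (u, \<one>\<^bsub>Fr (Suc n)\<^esub>)) (test_block n h) =
      test_block n (conj_by (Fr n) h u)"
    using h uc by (simp add: test_block_def conj_by_DirProd F.is_group FX.is_group)
  then show ?thesis
    using D.hurwitz_block_conj[OF closed k test_block_closed[OF h] group_prod_test_block[OF h]]
    by simp
qed

text \<open>The generator \<open>X\<^sub>n\<^sub>+\<^sub>1\<close> singles out the last entry: counting its exponent shows that a sequence of
  Hurwitz moves must carry that entry to itself up to conjugation.\<close>

lemma exponent_sum_base_tuple:
  assumes "(u, x) \<in> set (base_tuple n vs)"
  shows "exponent_sum (Suc n) x = 0"
proof -
  let ?q = "group_prod (Fr (Suc n)) (map free_gen [1..<Suc n])"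
  interpret e: group_hom "Fr (Suc n)" integer_group "exponent_sum (Suc n)"
    by (simp add: group_hom_def group_hom_axioms_def group_free_group exponent_sum_hom)
  have 0: "group_prod integer_group ys = 0" if "set ys \<subseteq> {0}" for ys
    using that by (induction ys) (auto simp: group_prod_def)
  have "?q \<in> carrier (Fr (Suc n))" by (intro e.G.group_prod_closed free_gens_closed) simp
  \<comment> \<open>The list \<open>[1..<Suc n]\<close> stops at \<open>n\<close>, so the generator
    with index \<open>Suc n\<close> is not a factor.\<close>
  moreover have "exponent_sum (Suc n) ?q = 0"
    using e.hom_group_prod[OF free_gens_closed[of n "Suc n"]]
    by (simp add: 0 image_subset_iff exponent_sum_free_gen)
  ultimately have "exponent_sum (Suc n) (inv\<^bsub>Fr (Suc n)\<^esub> ?q) = 0"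
    by simp
  moreover have "exponent_sum (Suc n) \<one>\<^bsub>Fr (Suc n)\<^esub> = 0" using e.hom_one by simp
  ultimately show ?thesis
    using assms by (auto simp: set_base_tuple exponent_sum_free_gen)
qed

text \<open>Every move conjugates by an element of the subgroup \<open>K\<close> of pairs with the same image in
  \<open>F\<^sub>n / N\<close>, where \<open>X\<^sub>i\<close> is sent to \<open>z\<^sub>i\<close> for \<open>i \<le> n\<close> and \<open>X\<^sub>n\<^sub>+\<^sub>1\<close> to \<open>1\<close>.\<close>

lemma hurwitz_steps_imp_conj_normal_closure:
  assumes vs: "set vs \<subseteq> carrier (Fr n)"
    and N: "N = normal_closure (Fr n) (set vs)"
    and h: "h \<in> N" "h' \<in> carrier (Fr n)"
    and steps: "(hurwitz_step (Fr n \<times>\<times> Fr (Suc n)))\<^sup>*\<^sup>* (base_tuple n vs @ test_block n h)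
      (base_tuple n vs @ test_block n h')"
  shows "\<exists>u \<in> N. conj_by (Fr n) h u = h'"
proof -
  let ?F = "Fr n" and ?FX = "Fr (Suc n)"
  let ?Q = "?F Mod N"
  define x where "x = (free_gen (Suc n) :: nat word)"
  define f where "f u = N #>\<^bsub>?F\<^esub> u" for u
  \<comment> \<open>The value \<open>N\<close> is the identity coset.\<close>
  define t where "t = word_val ?Q (\<lambda>j. if j = Suc n then N else f (free_gen j))"
  interpret N: normal N ?F
    unfolding N using vs by (intro normal_normal_closure group_free_group)
  interpret FX: group ?FX by (rule group_free_group)
  interpret Q: group ?Q by (rule N.factorgroup_is_group)
  interpret D: group "?F \<times>\<times> ?FX" by (intro DirProd_group N.is_group FX.is_group)
  interpret f: group_hom ?F ?Q f
    unfolding f_def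
    by (simp add: group_hom_def group_hom_axioms_def N.is_group Q.is_group N.r_coset_hom_Mod)
  have one_Q: "\<one>\<^bsub>?Q\<^esub> = N" by (simp add: FactGroup_def)
  have gens: "(\<lambda>j. if j = Suc n then N else f (free_gen j)) \<in> {1..Suc n} \<rightarrow> carrier ?Q"
    using Q.one_closed one_Q by (auto intro!: f.hom_closed)
  interpret t: group_hom ?FX ?Q t
    unfolding t_def using Q.word_val_hom[OF gens]
    by (simp add: group_hom_def group_hom_axioms_def FX.is_group Q.is_group)
  have xc: "x \<in> carrier ?FX" by (simp add: x_def)
  have f_one_iff: "f u = \<one>\<^bsub>?Q\<^esub> \<longleftrightarrow> u \<in> N" if "u \<in> carrier ?F" for u
    using that N.coset_join1[OF _ that N.subgroup_axioms] N.rcos_const one_Q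
    by (auto simp: f_def N.subset)
  have f_N: "f u = N" if "u \<in> N" for u
    using that f_one_iff one_Q by auto
  have inv_N: "inv\<^bsub>?Q\<^esub> N = N" using Q.inv_one by (simp only: one_Q)
  have t_x: "t x = \<one>\<^bsub>?Q\<^esub>"
    unfolding t_def x_def one_Q
    using Q.one_closed one_Q by (subst Q.word_val_free_gen) auto
  have t_gen: "t (free_gen j) = f (free_gen j)" if "j \<in> {1..n}" for j
    unfolding t_def using that by (subst Q.word_val_free_gen) (auto intro!: f.hom_closed)
  let ?K = "{(u, x). u \<in> carrier ?F \<and> x \<in> carrier ?FX \<and> f u = t x}"
  have K: "subgroup ?K (?F \<times>\<times> ?FX)"
    by (rule subgroup_equalizer) (rule f.group_hom_axioms t.group_hom_axioms)+
  have vsN: "set vs \<subseteq> N" unfolding N normal_closure_def by blast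
  have "group_prod ?F ys \<in> N" if "set ys \<subseteq> N" for ys
    using that by (induction ys) auto
  note prodN = this[OF vsN]
  have "t (group_prod ?FX (map free_gen [1..<Suc n])) = f (group_prod ?F (map free_gen [1..<Suc n]))"
    using t.hom_group_prod[OF free_gens_closed] f.hom_group_prod[OF free_gens_closed]
    by (auto simp: t_gen intro!: arg_cong[of _ _ "group_prod ?Q"])
  then have "set (base_tuple n vs) \<subseteq> ?K"
    using base_tuple_closed[OF vs] vsN prodN
      N.group_prod_closed[OF free_gens_closed[OF le_refl]]
      FX.group_prod_closed[OF free_gens_closed[of n "Suc n"]]
    by (auto simp: set_base_tuple f_N inv_N t_gen)
  \<comment> \<open>Here \<open>h\<close> lies in \<open>N\<close> and \<open>t\<close> kills
    \<open>x\<close>, so both coordinates go to the identity.\<close>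
  moreover have "set (test_block n h) \<subseteq> ?K"
    using h(1) xc t_x by (auto simp: test_block_def f_N inv_N x_def)
  ultimately have subset: "set (base_tuple n vs @ test_block n h) \<subseteq> ?K" by simp
  have "(h, x) \<in> set (base_tuple n vs @ test_block n h)" by (simp add: test_block_def x_def)
  then have "\<exists>k \<in> ?K. conj_by (?F \<times>\<times> ?FX) (h, x) k \<in> set (base_tuple n vs @ test_block n h')"
    by (rule D.hurwitz_steps_conjugates[OF steps K subset, THEN conjunct2, THEN bspec])
  then obtain k where k: "k \<in> ?K"
      "conj_by (?F \<times>\<times> ?FX) (h, x) k \<in> set (base_tuple n vs @ test_block n h')" ..
  obtain k1 k2 where k12: "k = (k1, k2)" "k1 \<in> carrier ?F" "k2 \<in> carrier ?FX" "f k1 = t k2"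
    using k(1) by auto
  have mem: "(conj_by ?F h k1, conj_by ?FX x k2) \<in> set (base_tuple n vs @ test_block n h')"
    using k(2) k12 h(1) xc by (simp add: conj_by_DirProd N.is_group FX.is_group)
  \<comment> \<open>Second coordinates have exponent 0 in the base tuple and -1 and 1 in the block;
    only the last entry matches a conjugate of \<open>x\<close>.\<close>
  have "exponent_sum (Suc n) (conj_by ?FX x k2) = 1"
    using xc k12 by (simp add: exponent_sum_conj_by) (simp add: x_def exponent_sum_free_gen)
  moreover have "exponent_sum (Suc n) (inv\<^bsub>?FX\<^esub> x) = -1"
    using xc by (simp add: exponent_sum_inv) (simp add: x_def exponent_sum_free_gen)
  ultimately have eq: "conj_by ?F h k1 = h'" "conj_by ?FX x k2 = x"
    using mem exponent_sum_base_tuple[of "conj_by ?F h k1" "conj_by ?FX x k2" n vs]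
    by (auto simp: test_block_def x_def[symmetric])
  have "x \<otimes>\<^bsub>?FX\<^esub> k2 = k2 \<otimes>\<^bsub>?FX\<^esub> conj_by ?FX x k2"
    using xc k12 by (simp add: conj_by_def FX.m_assoc[symmetric])
  then have comm: "x \<otimes>\<^bsub>?FX\<^esub> k2 = k2 \<otimes>\<^bsub>?FX\<^esub> x" using eq by simp
  have "has_no_root ?FX x" unfolding x_def by (rule has_no_root_free_gen)
  then obtain m :: int where "k2 = x [^]\<^bsub>?FX\<^esub> m"
    by (rule centralizer_no_root[OF xc _ k12(3) comm])
  \<comment> \<open>Since \<open>f k1 = t k2\<close>, this puts the first conjugator
    \<open>k1\<close> into \<open>N\<close>.\<close>
  then have "t k2 = \<one>\<^bsub>?Q\<^esub>" by (simp only: t.hom_int_pow[OF xc] t_x Q.int_pow_one)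
  then show ?thesis using eq(1) k12 f_one_iff by auto
qed

text \<open>Rootlessness of \<open>h\<close> enters here: its centralizer consists of its powers and
  thus lies in \<open>N\<close>, so conjugates of \<open>h\<close> detect cosets of
  \<open>N\<close>.\<close>

lemma conj_no_root_eq_iff:
  assumes N: "N \<lhd> free_group S" and "h \<in> N" "has_no_root (free_group S) h"
    and a: "a \<in> carrier (free_group S)" and b: "b \<in> carrier (free_group S)"
  shows "(\<exists>u \<in> N. conj_by (free_group S) (conj_by (free_group S) h a) u = conj_by (free_group S) h b)
    \<longleftrightarrow> N #>\<^bsub>free_group S\<^esub> a = N #>\<^bsub>free_group S\<^esub> b"
proof -
  let ?F = "free_group S"
  interpret N: normal N ?F by fact
  interpret q: group_hom ?F "?F Mod N" "\<lambda>u. N #>\<^bsub>?F\<^esub> u"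
    by (simp add: group_hom_def group_hom_axioms_def N.is_group N.factorgroup_is_group N.r_coset_hom_Mod)
  have h: "h \<in> carrier ?F" using assms(2) by simp
  have in_N: "N #>\<^bsub>?F\<^esub> u = \<one>\<^bsub>?F Mod N\<^esub>" if "u \<in> N" for u
    using that N.rcos_const by (simp add: FactGroup_def)
  show ?thesis
  proof
    assume "\<exists>u \<in> N. conj_by ?F (conj_by ?F h a) u = conj_by ?F h b"
    then obtain u where u: "u \<in> N" "conj_by ?F (conj_by ?F h a) u = conj_by ?F h b" by blast
    \<comment> \<open>Moving \<open>b\<close> to the other side turns the equation of conjugates
      into the statement that this element centralizes \<open>h\<close>.\<close>
    let ?g = "a \<otimes>\<^bsub>?F\<^esub> u \<otimes>\<^bsub>?F\<^esub> inv\<^bsub>?F\<^esub> b"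
    have uc: "u \<in> carrier ?F" using u(1) by simp
    have g: "?g \<in> carrier ?F" using a b uc by simp
    have "conj_by ?F h ?g = conj_by ?F (conj_by ?F (conj_by ?F h a) u) (inv\<^bsub>?F\<^esub> b)"
      using h a b uc by (simp add: N.conj_by_conj_by N.m_assoc)
    then have "conj_by ?F h ?g = h" using u(2) h b by simp
    moreover have "h \<otimes>\<^bsub>?F\<^esub> ?g = ?g \<otimes>\<^bsub>?F\<^esub> conj_by ?F h ?g"
      unfolding conj_by_def using h g N.m_assoc[of ?g "inv\<^bsub>?F\<^esub> ?g"]
      by (metis N.inv_closed N.l_one N.m_assoc N.m_closed N.r_inv)
    ultimately obtain m :: int where "?g = h [^]\<^bsub>?F\<^esub> m"
      using centralizer_no_root[OF h assms(3) g] by metis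
    then have "?g \<in> N"
      using assms(2) N.subgroup_int_pow_closed[OF N.subgroup_axioms] by simp
    then show "N #>\<^bsub>?F\<^esub> a = N #>\<^bsub>?F\<^esub> b"
      using q.hom_eq_of_kernel[OF a uc b] in_N u(1) by blast
  next
    assume eq: "N #>\<^bsub>?F\<^esub> a = N #>\<^bsub>?F\<^esub> b"
    \<comment> \<open>This conjugator takes \<open>a\<close> to \<open>b\<close> exactly, and
      equality of the cosets places it in \<open>N\<close>.\<close>
    let ?u = "inv\<^bsub>?F\<^esub> a \<otimes>\<^bsub>?F\<^esub> b"
    have "N #>\<^bsub>?F\<^esub> ?u = \<one>\<^bsub>?F Mod N\<^esub>"
      using a b by (simp only: q.hom_mult q.hom_inv N.inv_closed eq q.H.l_inv q.hom_closed)
    then have "?u \<in> N"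
      using N.coset_join1[OF _ _ N.subgroup_axioms, of ?u] a b by (simp add: FactGroup_def N.subset)
    moreover have "conj_by ?F (conj_by ?F h a) ?u = conj_by ?F h b"
      using h a b by (simp add: N.conj_by_conj_by) (simp add: N.m_assoc[symmetric])
    ultimately show "\<exists>u \<in> N. conj_by ?F (conj_by ?F h a) u = conj_by ?F h b" by blast
  qed
qed

theorem theorem4p8:
  fixes n :: nat
    and Rs :: "nat word list"
    and a b :: "nat word"
    and i :: "nat word \<times> nat word \<Rightarrow> nat word \<times> nat word"
    and H :: "nat word"
  assumes "n \<ge> 2"
    and "set Rs \<subseteq> words_over {1..n}"
    and "\<exists>r \<in> set Rs. free_word {1..n} r \<noteq> \<one>\<^bsub>Fr n\<^esub>"
    and "a \<in> words_over {1..n}"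
    and "b \<in> words_over {1..n}"
    and "i \<in> mon (Fr n \<times>\<times> Fr (Suc n)) (Fr 2 \<times>\<times> Fr 2)"
    and "H \<in> N_closure n Rs"
    and "has_no_root (Fr n) H"
  shows "presented_word {1..n} (set Rs) a = presented_word {1..n} (set Rs) b \<longleftrightarrow>
    hurwitz_equivalent (Fr 2 \<times>\<times> Fr 2) (FTL_B n Rs i H a) (FTL_B n Rs i H b)"
proof -
  let ?D = "Fr n \<times>\<times> Fr (Suc n)" and ?vs = "V_list n Rs" and ?N = "N_closure n Rs"
  let ?h = "\<lambda>c. conj_by (Fr n) H (phi n c)"
  let ?T = "\<lambda>c. base_tuple n ?vs @ test_block n (?h c)"
  have vs: "set ?vs \<subseteq> carrier (Fr n)"
    using assms(2) by (auto simp: V_list_def phi_def intro: free_word_closed)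
  have N: "?N = normal_closure (Fr n) (set ?vs)" by (simp add: N_closure_def)
  have N': "?N = relator_closure {1..n} (set Rs)"
    by (simp add: N_closure_def relator_closure_def V_list_def phi_def)
  interpret N: normal ?N "Fr n"
    unfolding N' using assms(2) by (rule normal_relator_closure)
  have ab: "phi n a \<in> carrier (Fr n)" "phi n b \<in> carrier (Fr n)"
    using assms(4,5) by (auto simp: phi_def intro: free_word_closed)
  \<comment> \<open>Normality keeps the conjugates of \<open>H\<close> in \<open>N\<close>, as the
    converse direction requires of the test block.\<close>
  have hN: "?h c \<in> ?N" if "phi n c \<in> carrier (Fr n)" for c
    using that assms(7) by (simp add: conj_by_def N.inv_op_closed1)
  have closed: "set (?T c) \<subseteq> carrier ?D" if "phi n c \<in> carrier (Fr n)" for c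
    using that base_tuple_closed[OF vs] test_block_closed[of "?h c" n] hN[OF that] by simp
  have "hurwitz_equivalent (Fr 2 \<times>\<times> Fr 2) (FTL_B n Rs i H a) (FTL_B n Rs i H b) \<longleftrightarrow>
      (hurwitz_step (Fr 2 \<times>\<times> Fr 2))\<^sup>*\<^sup>* (map i (?T a)) (map i (?T b))"
    by (simp only: hurwitz_equivalent_iff FTL_B_def FTL_s2_def FTL_s1_eq)
  \<comment> \<open>Injectivity of \<open>i\<close> moves the question from the target group back to
    \<open>?D\<close>.\<close>
  also have "\<dots> \<longleftrightarrow> (hurwitz_step ?D)\<^sup>*\<^sup>* (?T a) (?T b)"
    using closed ab assms(6) by (intro hurwitz_steps_mon DirProd_group group_free_group) auto
  also have "\<dots> \<longleftrightarrow> (\<exists>u \<in> ?N. conj_by (Fr n) (?h a) u = ?h b)"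
  proof
    assume steps: "(hurwitz_step ?D)\<^sup>*\<^sup>* (?T a) (?T b)"
    have "?h b \<in> carrier (Fr n)" using hN[OF ab(2)] by simp
    from hurwitz_steps_imp_conj_normal_closure[OF vs N hN[OF ab(1)] this steps]
    show "\<exists>u \<in> ?N. conj_by (Fr n) (?h a) u = ?h b" .
  next
    assume "\<exists>u \<in> ?N. conj_by (Fr n) (?h a) u = ?h b"
    then obtain u where u: "u \<in> ?N" "conj_by (Fr n) (?h a) u = ?h b" by blast
    have "?h a \<in> carrier (Fr n)" using hN[OF ab(1)] by simp
    from hurwitz_steps_conj_normal_closure[OF vs this u(1)[unfolded N]]
    show "(hurwitz_step ?D)\<^sup>*\<^sup>* (?T a) (?T b)" unfolding u(2) .
  qed
  also have "\<dots> \<longleftrightarrow> ?N #>\<^bsub>Fr n\<^esub> phi n a = ?N #>\<^bsub>Fr n\<^esub> phi n b"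
    by (rule conj_no_root_eq_iff) (use N.normal_axioms assms ab in auto)
  also have "\<dots> \<longleftrightarrow> presented_word {1..n} (set Rs) a = presented_word {1..n} (set Rs) b"
    using assms(2,4,5) by (simp add: presented_word_eq_coset N' phi_def)
  finally show ?thesis by simp
qed

end
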